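(* For all positive integers $b,k,h$, the number $p_{3D,min}(b,k,h)$ of polyominoes inscribed in the $b\times k\times h$ rectangular prism with minimal volume $b+k+h-2$ satisfies $$p_{3D,min}(b,k,h)=diag(b,k,h)+p_{2D\times2D}(b,k,h)+sc(b,k,h),$$ where $diag$, $p_{2D\times 2D}$ and $sc$ are the numbers of diagonal polyominoes, $2D\times2D$ polyominoes and skew cross polyominoes inscribed in that prism (these three families being disjoint and their union being the set of all minimal inscribed polyominoes).
   Context: Cells are unit cubes indexed by integer triples, adjacent when they share a face; a polyomino is a finite nonempty face-connected set of cells. A polyomino is inscribed in a box if contained in it and meeting all six faces; it is minimal if it has (sum of side lengths) $-2$ cells. A layer is a set of cells with one coordinate fixed. A planar corner-polyomino with corner $d$ is a polyomino contained in a layer which is a minimal polyomino inscribed in its own bounding box and contains the cell $d$, $d$ being a corner cell of that bounding box. For cells $c,c'$, $\mathrm{Box}(c,c')$ is the smallest box containing both; a 3D stair from $c$ to $c'$ is a minimal polyomino inscribed in $\mathrm{Box}(c,c')$ containing $c,c'$. A pilar is a straight row of cells parallel to an axis ending on a face of the prism. (1) Diagonal: a minimal inscribed $P$ is diagonal along the space diagonal joining opposite corner cells $A,B$ if it consists of a 3D stair from $c_1$ to $c_2$, plus optionally at $c_1$ a minimal polyomino inscribed in $\mathrm{Box}(A,c_1)$ containing $c_1$ in which $c_1$ has $2$ or $3$ neighbours or which is a 2D hook (two perpendicular full rows of a rectangle meeting at a corner cell), and similarly at $c_2$ inside $\mathrm{Box}(c_2,B)$, meeting the stair only at $c_1$,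 resp. $c_2$. $P$ is a diagonal polyomino if it is diagonal along at least one space diagonal. (2) $2D\times2D$: for some assignment of the three axes to roles $u,v,w$, $P$ consists of a straight segment $M$ of at least two cells along $v$ with distinct end cells $e_1,e_2$; a planar corner-polyomino $Q_1$ with corner $e_1$ in the layer $u=u(e_1)$, lying on the side of $e_1$ away from $M$ in the $v$ direction and of extent at least $2$ along $w$; a pilar $L_1$ of at least one cell starting next to $e_1$ along $w$, in the direction opposite to the $w$-extension of $Q_1$ (so $Q_1\cup L_1$ spans the prism in the $w$ direction); a planar corner-polyomino $Q_2$ with corner $e_2$ in the layer $w=w(e_2)$, lying on the side of $e_2$ away from $M$ in the $v$ direction and of extent at least $2$ along $u$; and a pilar $L_2$ of at least one cell starting next to $e_2$ along $u$ opposite to the $u$-extension of $Q_2$. (3) Skew cross: $P$ has a cell $c$ with exactly three neighbours $d_1,d_2,d_3$ in $P$ (either two of them opposite, "type a", or the three contact faces sharing a vertex of $c$, "type b") such that $P\setminus\{c\}$ is the disjoint union of three planar corner-polyominoes $Q_i$ with corner $d_i$, $Q_i$ lying in a layer containing the line through $c$ and $d_i$, on the side of $d_i$ away from $c$, with extent at least $2$ in the in-layer direction perpendicular to $cd_i$, the three layers being mutually perpendicular. *)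

theory Defs
  imports "HOL-Analysis.Cartesian_Space"
begin

text \<open>
  Coordinates are indexed by the three-element type \<open>3\<close>, whose elements also serve as the names of
  the axes.
\<close>

type_synonym cell = "int ^ 3"

definition adjacent :: "cell \<Rightarrow> cell \<Rightarrow> bool" where
  "adjacent c d \<longleftrightarrow> (\<exists>i. \<bar>c $ i - d $ i\<bar> = 1 \<and> (\<forall>j. j \<noteq> i \<longrightarrow> c $ j = d $ j))"

definition face_connected :: "cell set \<Rightarrow> bool" where
  "face_connected P \<longleftrightarrow>
     (\<forall>c\<in>P. \<forall>d\<in>P. (c, d) \<in> {(x, y). x \<in> P \<and> y \<in> P \<and> adjacent x y}\<^sup>*)"

definition polyomino :: "cell set \<Rightarrow> bool" where
  "polyomino P \<longleftrightarrow> finite P \<and> P \<noteq> {} \<and> face_connected P"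

text \<open>
  A box is given by any pair of opposite corner cells \<open>a\<close>, \<open>b\<close>. Its side along axis \<open>i\<close> is then
  \<open>\<bar>a $ i - b $ i\<bar> + 1\<close>, and its faces are at \<open>x $ i = a $ i\<close> and \<open>x $ i = b $ i\<close>.
\<close>

definition Box :: "cell \<Rightarrow> cell \<Rightarrow> cell set" where
  "Box a b = {x. \<forall>i. min (a $ i) (b $ i) \<le> x $ i \<and> x $ i \<le> max (a $ i) (b $ i)}"

definition inscribed :: "cell \<Rightarrow> cell \<Rightarrow> cell set \<Rightarrow> bool" where
  "inscribed a b P \<longleftrightarrow>
     P \<subseteq> Box a b \<and> (\<forall>i. (\<exists>x\<in>P. x $ i = a $ i) \<and> (\<exists>x\<in>P. x $ i = b $ i))"

definition minimal_inscribed :: "cell \<Rightarrow> cell \<Rightarrow> cell set \<Rightarrow> bool" where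
  "minimal_inscribed a b P \<longleftrightarrow>
     polyomino P \<and> inscribed a b P \<and>
     int (card P) = (\<Sum>i\<in>UNIV. \<bar>a $ i - b $ i\<bar> + 1) - 2"

definition layer :: "3 \<Rightarrow> int \<Rightarrow> cell set" where
  "layer i t = {x. x $ i = t}"

text \<open>
  The planar corner-polyominoes with corner \<open>d\<close> in the layer through \<open>d\<close> orthogonal to axis \<open>n\<close>.
  A box in which \<open>Q\<close> is inscribed is the bounding box of \<open>Q\<close>, so \<open>d'\<close> below is the corner
  opposite to \<open>d\<close> of the bounding box.
\<close>

definition planar_corner :: "3 \<Rightarrow> cell \<Rightarrow> cell set \<Rightarrow> bool" where
  "planar_corner n d Q \<longleftrightarrow>
     Q \<subseteq> layer n (d $ n) \<and> d \<in> Q \<and> (\<exists>d'. minimal_inscribed d d' Q)"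

definition extent :: "3 \<Rightarrow> cell set \<Rightarrow> int" where
  "extent i Q = Max ((\<lambda>x. x $ i) ` Q) - Min ((\<lambda>x. x $ i) ` Q) + 1"

definition on_line :: "3 \<Rightarrow> cell \<Rightarrow> cell \<Rightarrow> bool" where
  "on_line i e f \<longleftrightarrow> (\<forall>j. j \<noteq> i \<longrightarrow> e $ j = f $ j)"

definition stair :: "cell \<Rightarrow> cell \<Rightarrow> cell set \<Rightarrow> bool" where
  "stair c c' S \<longleftrightarrow> minimal_inscribed c c' S \<and> c \<in> S \<and> c' \<in> S"

subsection \<open>Diagonal polyominoes\<close>

text \<open>
  In \<open>hook\<close>, the rectangle is \<open>Box p q\<close> and \<open>d\<close> is the corner cell where the two rows meet.
\<close>

definition hook :: "cell set \<Rightarrow> bool" where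
  "hook T \<longleftrightarrow>
     (\<exists>d p q i j. i \<noteq> j \<and> p \<noteq> d \<and> q \<noteq> d \<and> on_line i d p \<and> on_line j d q \<and>
        T = Box d p \<union> Box d q)"

text \<open>
  The possible pieces attached to a stair \<open>S\<close> at its end \<open>c\<close>, towards the corner \<open>A\<close> of the prism;
  the empty set stands for the absence of a piece.
\<close>

definition end_piece :: "cell \<Rightarrow> cell \<Rightarrow> cell set \<Rightarrow> cell set \<Rightarrow> bool" where
  "end_piece A c S T \<longleftrightarrow>
     T = {} \<or>
     (minimal_inscribed A c T \<and> c \<in> T \<and>
      (card {x \<in> T. adjacent c x} \<in> {2, 3} \<or> hook T) \<and>
      T \<inter> S = {c})"

definition opposite_corners :: "cell \<Rightarrow> cell \<Rightarrow> cell \<Rightarrow> cell \<Rightarrow> bool" where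
  "opposite_corners a b A B \<longleftrightarrow> (\<forall>i. {A $ i, B $ i} = {a $ i, b $ i})"

text \<open>
  The conditions \<open>c\<^sub>1 \<in> Box A c\<^sub>2\<close> and \<open>c\<^sub>2 \<in> Box c\<^sub>1 B\<close> say that \<open>A\<close>, \<open>c\<^sub>1\<close>, \<open>c\<^sub>2\<close>, \<open>B\<close> occur in this
  order along the diagonal. As \<open>P\<close> is inscribed, \<open>c\<^sub>1 = A\<close> if the piece at \<open>c\<^sub>1\<close> is absent,
  and likewise at \<open>c\<^sub>2\<close>.
\<close>

definition diagonal_along :: "cell \<Rightarrow> cell \<Rightarrow> cell set \<Rightarrow> bool" where
  "diagonal_along A B P \<longleftrightarrow>
     minimal_inscribed A B P \<and>
     (\<exists>c\<^sub>1 c\<^sub>2 S T\<^sub>1 T\<^sub>2. c\<^sub>1 \<in> Box A c\<^sub>2 \<and> c\<^sub>2 \<in> Box c\<^sub>1 B \<and>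
        stair c\<^sub>1 c\<^sub>2 S \<and> end_piece A c\<^sub>1 S T\<^sub>1 \<and> end_piece B c\<^sub>2 S T\<^sub>2 \<and>
        P = S \<union> T\<^sub>1 \<union> T\<^sub>2)"

definition diagonal :: "cell \<Rightarrow> cell \<Rightarrow> cell set \<Rightarrow> bool" where
  "diagonal a b P \<longleftrightarrow> (\<exists>A B. opposite_corners a b A B \<and> diagonal_along A B P)"

subsection \<open>2D x 2D polyominoes\<close>

text \<open>
  The pilar along axis \<open>i\<close> of the prism \<open>Box a b\<close> that consists of the cells from \<open>f\<close> to \<open>g\<close>, where
  \<open>g\<close> lies on a face of the prism.
\<close>

definition pilar :: "cell \<Rightarrow> cell \<Rightarrow> 3 \<Rightarrow> cell \<Rightarrow> cell \<Rightarrow> cell set \<Rightarrow> bool" where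
  "pilar a b i f g L \<longleftrightarrow> on_line i f g \<and> g $ i \<in> {a $ i, b $ i} \<and> L = Box f g"

text \<open>
  The part at the end \<open>e\<close> of a segment from \<open>e\<close> to \<open>e'\<close> along \<open>v\<close>: a planar corner-polyomino \<open>Q\<close> in
  the layer orthogonal to \<open>u\<close>, extending from \<open>e\<close> in the direction \<open>s\<close> along \<open>w\<close>, and a pilar \<open>L\<close>
  in the direction \<open>-s\<close>.
\<close>

definition arm_with_pilar ::
  "cell \<Rightarrow> cell \<Rightarrow> 3 \<Rightarrow> 3 \<Rightarrow> 3 \<Rightarrow> cell \<Rightarrow> cell \<Rightarrow> cell set \<Rightarrow> cell set \<Rightarrow> bool" where
  "arm_with_pilar a b u v w e e' Q L \<longleftrightarrow>
     planar_corner u e Q \<and>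
     (\<forall>x\<in>Q. (x $ v - e $ v) * (e' $ v - e $ v) \<le> 0) \<and>
     extent w Q \<ge> 2 \<and>
     (\<exists>s\<in>{1, -1}. (\<forall>x\<in>Q. s * (x $ w - e $ w) \<ge> 0) \<and>
        (\<exists>f g. f = e - axis w s \<and> s * (g $ w - f $ w) \<le> 0 \<and> pilar a b w f g L))"

definition two_by_two :: "cell \<Rightarrow> cell \<Rightarrow> cell set \<Rightarrow> bool" where
  "two_by_two a b P \<longleftrightarrow>
     minimal_inscribed a b P \<and>
     (\<exists>u v w e\<^sub>1 e\<^sub>2 Q\<^sub>1 L\<^sub>1 Q\<^sub>2 L\<^sub>2. distinct [u, v, w] \<and>
        e\<^sub>1 \<noteq> e\<^sub>2 \<and> on_line v e\<^sub>1 e\<^sub>2 \<and>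
        arm_with_pilar a b u v w e\<^sub>1 e\<^sub>2 Q\<^sub>1 L\<^sub>1 \<and>
        arm_with_pilar a b w v u e\<^sub>2 e\<^sub>1 Q\<^sub>2 L\<^sub>2 \<and>
        P = Box e\<^sub>1 e\<^sub>2 \<union> Q\<^sub>1 \<union> L\<^sub>1 \<union> Q\<^sub>2 \<union> L\<^sub>2)"

subsection \<open>Skew crosses\<close>

text \<open>
  The vertices of the unit cube \<open>c\<close>, as integer points. For adjacent cells \<open>c\<close> and \<open>d\<close>, the set
  \<open>vertices c \<inter> vertices d\<close> consists of the vertices of their contact face.
\<close>

definition vertices :: "cell \<Rightarrow> (int ^ 3) set" where
  "vertices c = {x. \<forall>i. x $ i = c $ i \<or> x $ i = c $ i + 1}"

definition opposite_neighbours :: "cell \<Rightarrow> cell \<Rightarrow> cell \<Rightarrow> bool" where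
  "opposite_neighbours c d d' \<longleftrightarrow> d - c = c - d'"

definition type_a :: "cell \<Rightarrow> cell \<Rightarrow> cell \<Rightarrow> cell \<Rightarrow> bool" where
  "type_a c d\<^sub>1 d\<^sub>2 d\<^sub>3 \<longleftrightarrow>
     opposite_neighbours c d\<^sub>1 d\<^sub>2 \<or> opposite_neighbours c d\<^sub>1 d\<^sub>3 \<or> opposite_neighbours c d\<^sub>2 d\<^sub>3"

definition type_b :: "cell \<Rightarrow> cell \<Rightarrow> cell \<Rightarrow> cell \<Rightarrow> bool" where
  "type_b c d\<^sub>1 d\<^sub>2 d\<^sub>3 \<longleftrightarrow>
     vertices c \<inter> vertices d\<^sub>1 \<inter> vertices d\<^sub>2 \<inter> vertices d\<^sub>3 \<noteq> {}"

text \<open>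
  In \<open>skew_arm\<close>, \<open>i\<close> is the axis of the line through the adjacent cells \<open>c\<close> and \<open>d\<close>, the layer of
  \<open>Q\<close> is orthogonal to \<open>n\<close>, and \<open>j\<close> is the in-layer axis perpendicular to that line.
\<close>

definition skew_arm :: "cell \<Rightarrow> cell \<Rightarrow> 3 \<Rightarrow> cell set \<Rightarrow> bool" where
  "skew_arm c d n Q \<longleftrightarrow>
     planar_corner n d Q \<and>
     (\<exists>i j. distinct [n, i, j] \<and> on_line i c d \<and>
        (\<forall>x\<in>Q. (x $ i - d $ i) * (d $ i - c $ i) \<ge> 0) \<and>
        extent j Q \<ge> 2)"

definition skew_cross :: "cell \<Rightarrow> cell \<Rightarrow> cell set \<Rightarrow> bool" where
  "skew_cross a b P \<longleftrightarrow>
     minimal_inscribed a b P \<and>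
     (\<exists>c\<in>P. \<exists>d\<^sub>1 d\<^sub>2 d\<^sub>3. distinct [d\<^sub>1, d\<^sub>2, d\<^sub>3] \<and>
        {x \<in> P. adjacent c x} = {d\<^sub>1, d\<^sub>2, d\<^sub>3} \<and>
        (type_a c d\<^sub>1 d\<^sub>2 d\<^sub>3 \<or> type_b c d\<^sub>1 d\<^sub>2 d\<^sub>3) \<and>
        (\<exists>Q\<^sub>1 Q\<^sub>2 Q\<^sub>3 n\<^sub>1 n\<^sub>2 n\<^sub>3. distinct [n\<^sub>1, n\<^sub>2, n\<^sub>3] \<and>
           skew_arm c d\<^sub>1 n\<^sub>1 Q\<^sub>1 \<and> skew_arm c d\<^sub>2 n\<^sub>2 Q\<^sub>2 \<and> skew_arm c d\<^sub>3 n\<^sub>3 Q\<^sub>3 \<and>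
           P - {c} = Q\<^sub>1 \<union> Q\<^sub>2 \<union> Q\<^sub>3 \<and>
           Q\<^sub>1 \<inter> Q\<^sub>2 = {} \<and> Q\<^sub>1 \<inter> Q\<^sub>3 = {} \<and> Q\<^sub>2 \<inter> Q\<^sub>3 = {}))"

subsection \<open>The families in the prism\<close>

text \<open>
  The \<open>b \<times> k \<times> h\<close> prism is the fixed box \<open>Box 0 (top_cell b k h)\<close>, for positive \<open>b\<close>, \<open>k\<close>, \<open>h\<close>.
\<close>

definition top_cell :: "nat \<Rightarrow> nat \<Rightarrow> nat \<Rightarrow> cell" where
  "top_cell b k h = vector [int b - 1, int k - 1, int h - 1]"

definition min_polyominoes :: "nat \<Rightarrow> nat \<Rightarrow> nat \<Rightarrow> cell set set" where
  "min_polyominoes b k h =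
     {P. polyomino P \<and> inscribed 0 (top_cell b k h) P \<and> card P = b + k + h - 2}"

definition diag_polyominoes :: "nat \<Rightarrow> nat \<Rightarrow> nat \<Rightarrow> cell set set" where
  "diag_polyominoes b k h = {P. diagonal 0 (top_cell b k h) P}"

definition two_by_two_polyominoes :: "nat \<Rightarrow> nat \<Rightarrow> nat \<Rightarrow> cell set set" where
  "two_by_two_polyominoes b k h = {P. two_by_two 0 (top_cell b k h) P}"

definition skew_cross_polyominoes :: "nat \<Rightarrow> nat \<Rightarrow> nat \<Rightarrow> cell set set" where
  "skew_cross_polyominoes b k h = {P. skew_cross 0 (top_cell b k h) P}"

definition p_3D_min :: "nat \<Rightarrow> nat \<Rightarrow> nat \<Rightarrow> nat" where
  "p_3D_min b k h = card (min_polyominoes b k h)"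

definition diag :: "nat \<Rightarrow> nat \<Rightarrow> nat \<Rightarrow> nat" where
  "diag b k h = card (diag_polyominoes b k h)"

definition p_2Dx2D :: "nat \<Rightarrow> nat \<Rightarrow> nat \<Rightarrow> nat" where
  "p_2Dx2D b k h = card (two_by_two_polyominoes b k h)"

definition sc :: "nat \<Rightarrow> nat \<Rightarrow> nat \<Rightarrow> nat" where
  "sc b k h = card (skew_cross_polyominoes b k h)"

end

theory Submission
  imports Defs
begin

text \<open>
  A connected set has at most two cells fewer than the sum of its coordinate ranges, and if equality
  holds for \<open>P\<close>, it holds for all connected subsets of \<open>P\<close>. Hence, at every cell \<open>c\<close> of \<open>P\<close>, each of
  the six directions occurs in at most one component of \<open>P - {c}\<close>, and each component is entered
  through exactly one neighbour of \<open>c\<close>. The classification is read off from the way in which the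
  components of \<open>P - {c}\<close> partition the directions:

  \<^item> \<open>P\<close> is diagonal iff there are a cell \<open>c\<close> and a choice of signs for the axes such that every
    component lies in the corresponding orthant at \<open>c\<close> or in the opposite one.

  \<^item> If neither this is possible at \<open>c\<close> nor some component contains two opposite directions, then the
    directions are partitioned cyclically into \<open>{x, y}\<close>, \<open>{-y, z}\<close>, \<open>{-z, -x}\<close> up to signs, and
    \<open>P\<close> is a skew cross with centre \<open>c\<close>. Seen from any other cell, some component contains two opposite
    directions.

  \<^item> If at every cell some component contains two opposite directions, walking into such components
    eventually turns back along an edge; on its two sides lie opposite pairs of directions of different
    axes, and \<open>P\<close> is of type 2D x 2D. Conversely, such an edge gives every cell such a component.
\<close>

subsection \<open>Components of cell sets\<close>

text \<open>The number two comes from a single cell, which has three coordinate values; each further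
  cell adjacent to an earlier one brings at most one new value, in one coordinate. A connected part
  of \<open>P\<close> with surplus cells could not make up for them while it grows to
  \<open>P\<close>, so equality is inherited. Minimality is therefore expressed by counts of
  coordinate values, and boxes return only where pieces have to be exhibited. Since a direction at
  \<open>c\<close> belongs to one component only, being linked is a symmetric and transitive
  relation on directions, and the case distinction at a cell becomes a finite question about signs.
  The obstacle to disjointness is that one polyomino may admit several decompositions of the same
  kind, so decompositions cannot be compared piece by piece. The properties \<open>two_sided\<close>
  and \<open>coherent\<close> depend only on \<open>P\<close> and a cell, yet can be read off from
  any decomposition. For signs 1 and -1, a coherent cell is never two-sided, so the families are
  told apart by which cells are two-sided and, for the exceptional cell of a skew cross, by the
  absence of coherent signs.\<close>

definition adj_rel :: "cell set \<Rightarrow> (cell \<times> cell) set" where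
  "adj_rel A = {(x, y). x \<in> A \<and> y \<in> A \<and> adjacent x y}"

text \<open>The closure is reflexive, so \<open>x\<close> belongs to \<open>component A x\<close>
  even if \<open>x\<close> is not in \<open>A\<close>; to have the component inside
  \<open>A\<close>, membership of \<open>x\<close> is assumed.\<close>

definition component :: "cell set \<Rightarrow> cell \<Rightarrow> cell set" where
  "component A x = {y. (x, y) \<in> (adj_rel A)\<^sup>*}"

abbreviation coords :: "3 \<Rightarrow> cell set \<Rightarrow> int set" where
  "coords i C \<equiv> (\<lambda>x. x $ i) ` C"

lemma adjacent_sym: "adjacent x y \<longleftrightarrow> adjacent y x"
  unfolding adjacent_def by (metis abs_minus_commute)

lemma adjacent_neq: "adjacent x y \<Longrightarrow> x \<noteq> y"
  unfolding adjacent_def by auto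

lemma adjacentE:
  assumes "adjacent c d"
  obtains i s where "s = 1 \<or> s = -1" "d $ i = c $ i + s" "\<And>j. j \<noteq> i \<Longrightarrow> d $ j = c $ j"
proof -
  obtain i where i: "\<bar>c $ i - d $ i\<bar> = 1" "\<forall>j. j \<noteq> i \<longrightarrow> c $ j = d $ j"
    using assms unfolding adjacent_def by blast
  have "d $ i - c $ i = 1 \<or> d $ i - c $ i = -1" using i(1) by linarith
  then show ?thesis using i(2) by (intro that[of "d $ i - c $ i" i]) auto
qed

lemma adjacent_step:
  assumes "adjacent x y"
  shows "y $ i \<le> x $ i + 1" "x $ i \<le> y $ i + 1"
proof -
  obtain j s where "s = 1 \<or> s = -1" "y $ j = x $ j + s" "\<And>k. k \<noteq> j \<Longrightarrow> y $ k = x $ k"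
    using adjacentE[OF assms] by metis
  then show "y $ i \<le> x $ i + 1" "x $ i \<le> y $ i + 1" by (cases "i = j"; auto)+
qed

lemma sym_adj_rel: "sym (adj_rel A)"
  unfolding adj_rel_def sym_def using adjacent_sym by blast

lemma component_self: "x \<in> component A x"
  by (simp add: component_def)

lemma component_sym: "y \<in> component A x \<Longrightarrow> x \<in> component A y"
  unfolding component_def using sym_adj_rel sym_rtrancl by (metis mem_Collect_eq symD)

lemma component_trans: "y \<in> component A x \<Longrightarrow> z \<in> component A y \<Longrightarrow> z \<in> component A x"
  unfolding component_def by simp

lemma component_eq: "y \<in> component A x \<Longrightarrow> component A y = component A x"
  using component_sym component_trans by blast

lemma component_step:
  "y \<in> component A x \<Longrightarrow> y \<in> A \<Longrightarrow> z \<in> A \<Longrightarrow> adjacent y z \<Longrightarrow> z \<in> component A x"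
  unfolding component_def adj_rel_def by (auto intro: rtrancl_into_rtrancl)

lemma component_induct [consumes 1, case_names base step]:
  assumes "y \<in> component A x" "R x"
    and "\<And>y z. y \<in> component A x \<Longrightarrow> y \<in> A \<Longrightarrow> z \<in> A \<Longrightarrow> adjacent y z \<Longrightarrow> R y \<Longrightarrow> R z"
  shows "R y"
proof -
  have "(x, y) \<in> (adj_rel A)\<^sup>*" using assms(1) by (simp add: component_def)
  then show ?thesis
  proof (induction rule: rtrancl_induct)
    case base then show ?case by (rule assms(2))
  next
    case (step y z)
    then show ?case using assms(3)[of y z] by (auto simp: component_def adj_rel_def)
  qed
qed

lemma component_subset: "x \<in> A \<Longrightarrow> component A x \<subseteq> A"
proof
  fix y assume "x \<in> A" "y \<in> component A x"
  from this(2,1) show "y \<in> A" by (induction rule: component_induct) auto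
qed

lemma component_mono:
  assumes "A \<subseteq> B" shows "component A x \<subseteq> component B x"
proof -
  have "adj_rel A \<subseteq> adj_rel B" using assms by (auto simp: adj_rel_def)
  then show ?thesis unfolding component_def using rtrancl_mono by blast
qed

lemma face_connected_component: "face_connected C \<longleftrightarrow> (\<forall>c\<in>C. C \<subseteq> component C c)"
  unfolding face_connected_def component_def adj_rel_def by blast

lemma face_connectedI:
  assumes "\<And>x. x \<in> C \<Longrightarrow> x \<in> component C c"
  shows "face_connected C"
  unfolding face_connected_component using assms component_sym component_trans by blast

lemma face_connectedD:
  "face_connected C \<Longrightarrow> C \<subseteq> A \<Longrightarrow> x \<in> C \<Longrightarrow> y \<in> C \<Longrightarrow> y \<in> component A x"
  unfolding face_connected_component using component_mono by blast

lemma component_in_component: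
  assumes "y \<in> component A x" "x \<in> A"
  shows "y \<in> component (component A x) x"
  using assms(1)
proof (induction rule: component_induct)
  case base show ?case by (rule component_self)
next
  case (step y z)
  then show ?case
    using component_step[of y "component A x" x z] component_step[of y A x z] by blast
qed

lemma face_connected_comp: "x \<in> A \<Longrightarrow> face_connected (component A x)"
  by (rule face_connectedI[of _ x]) (rule component_in_component)

lemma face_connected_singleton: "face_connected {x}"
  by (rule face_connectedI[of _ x]) (simp add: component_self)

lemma face_connected_Un:
  assumes "face_connected C" "face_connected D" "x \<in> C" "y \<in> D" "x = y \<or> adjacent x y"
  shows "face_connected (C \<union> D)"
proof (rule face_connectedI[of _ x])
  have y: "y \<in> component (C \<union> D) x"
    using assms(3-5) component_self[of x] component_step[of x "C \<union> D" x y] by blast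
  fix z assume "z \<in> C \<union> D"
  then show "z \<in> component (C \<union> D) x"
  proof
    assume "z \<in> C"
    then show ?thesis using face_connectedD[OF assms(1), of "C \<union> D" x z] assms(3) by blast
  next
    assume "z \<in> D"
    then have "z \<in> component (C \<union> D) y"
      using face_connectedD[OF assms(2), of "C \<union> D" y z] assms(4) by blast
    then show ?thesis using y component_trans by blast
  qed
qed

lemma face_connected_insert:
  "face_connected C \<Longrightarrow> y \<in> C \<Longrightarrow> adjacent y z \<Longrightarrow> face_connected (insert z C)"
  using face_connected_Un[OF _ face_connected_singleton, of C y z z] by simp

text \<open>Cutting a walk at its last visit to \<open>c\<close> leaves a walk in
  \<open>A - {c}\<close> that starts at a neighbour of \<open>c\<close>.\<close>

lemma component_exit:
  assumes "x \<in> component A c" "x \<noteq> c"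
  obtains e where "e \<in> A" "adjacent c e" "x \<in> component (A - {c}) e"
proof -
  have "x \<noteq> c \<longrightarrow> (\<exists>e\<in>A. adjacent c e \<and> x \<in> component (A - {c}) e)"
    using assms(1)
  proof (induction rule: component_induct)
    case base show ?case by simp
  next
    case (step y z)
    show ?case
    proof (cases "y = c")
      case True then show ?thesis using step component_self by blast
    next
      case False
      then obtain e where e: "e \<in> A" "adjacent c e" "y \<in> component (A - {c}) e" using step by blast
      have "z \<noteq> c \<Longrightarrow> z \<in> component (A - {c}) e"
        using component_step[OF e(3), of z] step False by blast
      then show ?thesis using e by blast
    qed
  qed
  then show ?thesis using assms(2) that by blast
qed

text \<open>Otherwise \<open>C\<close> would be closed under steps in \<open>P\<close> and contain
  everything reachable from its cells, including \<open>x\<close>.\<close>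

lemma component_extend:
  assumes "face_connected P" "x \<in> P" "C \<subseteq> P" "C \<noteq> {}" "x \<notin> C"
  obtains y z where "y \<in> C" "z \<in> P - C" "adjacent y z"
proof -
  obtain c where c: "c \<in> C" using assms by blast
  have "x \<in> component P c" using face_connectedD[OF assms(1)] c assms by blast
  moreover have "w \<in> C" if "w \<in> component P c" "\<not> (\<exists>y\<in>C. \<exists>z\<in>P - C. adjacent y z)" for w
    using that(1)
  proof (induction rule: component_induct)
    case base show ?case by (rule c)
  next
    case (step y z) then show ?case using that(2) by blast
  qed
  ultimately show ?thesis using assms(5) that by blast
qed

section \<open>Coordinate values of connected sets\<close>

lemma coords_connected:
  assumes "face_connected C" "x \<in> C" "y \<in> C" "x $ i \<le> t" "t \<le> y $ i"
  shows "t \<in> coords i C"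
proof -
  have y: "y \<in> component C x" using face_connectedD[OF assms(1)] assms by blast
  \<comment> \<open>Discrete intermediate value: a step changes a coordinate by at most one, so the
    walk from \<open>x\<close> stays below \<open>t\<close> until the value \<open>t\<close> is
    met.\<close>
  have "w \<in> C \<and> (t \<in> coords i C \<or> w $ i < t)" if "w \<in> component C x" for w
    using that
  proof (induction rule: component_induct)
    case base show ?case using assms by force
  next
    case (step y z)
    then show ?case using adjacent_step(1)[of y z i] by force
  qed
  from this[OF y] show ?thesis using assms by auto
qed

lemma coords_between:
  assumes "face_connected C" "x \<in> C" "y \<in> C" "(t - x $ i) * (t - y $ i) \<le> 0"
  shows "t \<in> coords i C"
proof -
  have "x $ i \<le> t \<and> t \<le> y $ i \<or> y $ i \<le> t \<and> t \<le> x $ i"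
    using assms(4) by (auto simp: mult_le_0_iff)
  then show ?thesis using coords_connected[OF assms(1)] assms(2,3) by blast
qed

text \<open>\<open>z\<close> differs from \<open>y\<close> along one axis only, so its other
  coordinates already occur in \<open>C\<close>.\<close>

lemma sum_coords_insert:
  assumes "finite C" "y \<in> C" "adjacent y z"
  shows "(\<Sum>i\<in>UNIV. card (coords i (insert z C))) \<le> (\<Sum>i\<in>UNIV. card (coords i C)) + 1"
proof -
  obtain k s where k: "\<And>j. j \<noteq> k \<Longrightarrow> z $ j = y $ j" using adjacentE[OF assms(3)] by metis
  have "card (coords i (insert z C)) \<le> card (coords i C) + (if i = k then 1 else 0)" for i
  proof (cases "i = k")
    case True then show ?thesis by (simp add: card_insert_if assms(1))
  next
    case False
    then have "z $ i \<in> coords i C" using k assms(2) by force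
    then show ?thesis using False by (simp add: insert_absorb)
  qed
  then have "(\<Sum>i\<in>UNIV. card (coords i (insert z C)))
      \<le> (\<Sum>i\<in>UNIV. card (coords i C) + (if i = k then 1 else 0))"
    by (rule sum_mono)
  also have "\<dots> = (\<Sum>i\<in>UNIV. card (coords i C)) + 1" by (simp add: sum.distrib)
  finally show ?thesis .
qed

text \<open>\<open>C\<close> grows to \<open>P\<close> by adjacent cells, each bringing at most one
  new value. Started from one cell this bounds the values of a connected set; started from a larger
  \<open>C\<close> it compares the surplus of \<open>C\<close> with that of
  \<open>P\<close>.\<close>

lemma sum_coords_growth:
  assumes "finite P" "face_connected P" "C \<subseteq> P" "C \<noteq> {}"
  shows "(\<Sum>i\<in>UNIV. card (coords i P)) + card C \<le> (\<Sum>i\<in>UNIV. card (coords i C)) + card P"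
  using assms(3,4)
proof (induction "card (P - C)" arbitrary: C rule: less_induct)
  case less
  have fin: "finite C" using less.prems assms finite_subset by blast
  show ?case
  proof (cases "C = P")
    case True then show ?thesis by simp
  next
    case False
    then obtain x where "x \<in> P" "x \<notin> C" using less.prems by blast
    then obtain y z where yz: "y \<in> C" "z \<in> P - C" "adjacent y z"
      using component_extend[OF assms(2)] less.prems by metis
    have "P - insert z C \<subset> P - C" using yz by blast
    then have "card (P - insert z C) < card (P - C)" using assms(1) by (simp add: psubset_card_mono)
    then have "(\<Sum>i\<in>UNIV. card (coords i P)) + card (insert z C)
        \<le> (\<Sum>i\<in>UNIV. card (coords i (insert z C))) + card P"
      using less.hyps less.prems yz by blast
    moreover have "card (insert z C) = card C + 1" using yz fin by simp
    ultimately show ?thesis using sum_coords_insert[OF fin yz(1,3)] by linarith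
  qed
qed

lemma coords_inscribed:
  assumes "face_connected C" "inscribed a b C"
  shows "coords i C = {min (a $ i) (b $ i)..max (a $ i) (b $ i)}"
proof
  show "coords i C \<subseteq> {min (a $ i) (b $ i)..max (a $ i) (b $ i)}"
    using assms(2) unfolding inscribed_def Box_def by fastforce
  obtain x y where xy: "x \<in> C" "x $ i = a $ i" "y \<in> C" "y $ i = b $ i"
    using assms(2) unfolding inscribed_def by blast
  show "{min (a $ i) (b $ i)..max (a $ i) (b $ i)} \<subseteq> coords i C"
    using coords_connected[OF assms(1), of x y i] coords_connected[OF assms(1), of y x i] xy
    by (cases "a $ i \<le> b $ i") (auto simp: subset_iff)
qed

lemma sum_coords_inscribed:
  assumes "face_connected C" "inscribed a b C"
  shows "int (\<Sum>i\<in>UNIV. card (coords i C)) = (\<Sum>i\<in>UNIV. \<bar>a $ i - b $ i\<bar> + 1)"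
  unfolding of_nat_sum
  by (rule sum.cong) (auto simp: coords_inscribed[OF assms] max_def min_def)

subsection \<open>Minimal polyominoes\<close>

text \<open>Counts of coordinate values replace side lengths: in this form the condition mentions no
  box and passes to connected subsets.\<close>

locale minimal_polyomino =
  fixes P :: "cell set"
  assumes finite: "finite P" and nonempty: "P \<noteq> {}" and conn: "face_connected P"
    and card: "card P + 2 = (\<Sum>i\<in>UNIV. card (coords i P))"

lemma minimal_inscribed_iff:
  "minimal_inscribed a b P \<longleftrightarrow> minimal_polyomino P \<and> inscribed a b P"
proof -
  have "int (card P) = (\<Sum>i\<in>UNIV. \<bar>a $ i - b $ i\<bar> + 1) - 2
      \<longleftrightarrow> card P + 2 = (\<Sum>i\<in>UNIV. card (coords i P))"
    if "face_connected P" "inscribed a b P"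
    unfolding sum_coords_inscribed[OF that, symmetric] by linarith
  then show ?thesis
    unfolding minimal_inscribed_def minimal_polyomino_def polyomino_def by blast
qed

context minimal_polyomino
begin

text \<open>A squeeze: growth from one cell to \<open>C\<close> bounds the sum from above, growth
  from \<open>C\<close> to \<open>P\<close>, where equality holds, from below.\<close>

lemma card_connected:
  assumes "C \<subseteq> P" "C \<noteq> {}" "face_connected C"
  shows "card C + 2 = (\<Sum>i\<in>UNIV. card (coords i C))"
proof -
  obtain x where x: "x \<in> C" using assms by blast
  have "finite C" using assms finite finite_subset by blast
  from sum_coords_growth[OF this assms(3), of "{x}"] x
  have "(\<Sum>i\<in>UNIV. card (coords i C)) + 1 \<le> (\<Sum>i\<in>(UNIV :: 3 set). 1) + card C" by simp
  then have "(\<Sum>i\<in>UNIV. card (coords i C)) \<le> card C + 2" by simp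
  moreover have "(\<Sum>i\<in>UNIV. card (coords i P)) + card C \<le> (\<Sum>i\<in>UNIV. card (coords i C)) + card P"
    using sum_coords_growth[OF finite conn] assms by blast
  ultimately show ?thesis using card by linarith
qed

lemma minimal_connected:
  assumes "C \<subseteq> P" "C \<noteq> {}" "face_connected C"
  shows "minimal_polyomino C"
  using assms card_connected finite finite_subset by unfold_locales blast+

lemma minimal_inscribedI:
  assumes "C \<subseteq> P" "C \<noteq> {}" "face_connected C" "inscribed a b C"
  shows "minimal_inscribed a b C"
  using minimal_connected assms minimal_inscribed_iff by blast

lemma component_insert_connected:
  assumes "c \<in> P" "x \<in> P" "x \<noteq> c"
  shows "face_connected (insert c (component (P - {c}) x))"
proof -
  have "x \<in> component P c" using face_connectedD[OF conn] assms by blast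
  then obtain e where e: "e \<in> P" "adjacent c e" "x \<in> component (P - {c}) e"
    using component_exit assms(3) by metis
  then have "e \<in> component (P - {c}) x" using component_sym by blast
  then show ?thesis
    using face_connected_insert face_connected_comp[of x "P - {c}"] assms e(2) adjacent_sym by blast
qed

text \<open>
  If \<open>x\<close> and \<open>y\<close> lay in different components \<open>X\<close>, \<open>Y\<close> of \<open>P - {c}\<close>, then the connected sets
  \<open>X \<union> {c}\<close> and \<open>Y \<union> {c}\<close> would share one value in each coordinate and two values in
  coordinate \<open>i\<close>, so that their union would have more cells than its coordinate ranges allow.
\<close>

lemma separation:
  assumes c: "c \<in> P" and x: "x \<in> P" and y: "y \<in> P"
    and s: "s * (x $ i - c $ i) > 0" "s * (y $ i - c $ i) > 0"
  shows "y \<in> component (P - {c}) x"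
proof (rule ccontr)
  assume ny: "y \<notin> component (P - {c}) x"
  define X where "X = component (P - {c}) x"
  define Y where "Y = component (P - {c}) y"
  have neq: "x \<noteq> c" "y \<noteq> c" using s by auto
  have XY: "X \<inter> Y = {}"
  proof (rule ccontr)
    assume "X \<inter> Y \<noteq> {}"
    then obtain z where "z \<in> component (P - {c}) x" "z \<in> component (P - {c}) y"
      unfolding X_def Y_def by blast
    then show False using ny component_trans component_sym by metis
  qed
  have sub: "X \<subseteq> P - {c}" "Y \<subseteq> P - {c}"
    unfolding X_def Y_def
    using component_subset[of x "P - {c}"] component_subset[of y "P - {c}"] neq x y by auto
  then have fin: "finite X" "finite Y" using finite finite_subset by blast+
  have cx: "face_connected (insert c X)" and cy: "face_connected (insert c Y)"
    unfolding X_def Y_def using component_insert_connected c x y neq by auto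
  have in_X: "x \<in> X" "y \<in> Y" unfolding X_def Y_def by (auto intro: component_self)
  have un: "face_connected (insert c X \<union> insert c Y)"
    using face_connected_Un[OF cx cy, of c c] by simp
  have cardX: "card (insert c X) + 2 = (\<Sum>i\<in>UNIV. card (coords i (insert c X)))"
    and cardY: "card (insert c Y) + 2 = (\<Sum>i\<in>UNIV. card (coords i (insert c Y)))"
    and cardXY: "card (insert c X \<union> insert c Y) + 2
      = (\<Sum>i\<in>UNIV. card (coords i (insert c X \<union> insert c Y)))"
    using card_connected[OF _ _ cx] card_connected[OF _ _ cy] card_connected[OF _ _ un] sub c by blast+
  have "card (coords j (insert c X \<union> insert c Y)) + (if j = i then 2 else 1)
      \<le> card (coords j (insert c X)) + card (coords j (insert c Y))" for j
  proof -
    let ?A = "coords j (insert c X)" and ?B = "coords j (insert c Y)"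
    have "card ?A + card ?B = card (?A \<union> ?B) + card (?A \<inter> ?B)"
      using fin by (intro card_Un_Int) auto
    moreover have "?A \<union> ?B = coords j (insert c X \<union> insert c Y)" by blast
    moreover have "(if j = i then 2 else 1) \<le> card (?A \<inter> ?B)"
    proof (cases "j = i")
      case True
      \<comment> \<open>The value next to \<open>c $ i\<close> on the side of \<open>x\<close> and
        \<open>y\<close>; both connected sets take it.\<close>
      define t where "t = c $ i + sgn s"
      have t: "(t - c $ i) * (t - z $ i) \<le> 0" if "s * (z $ i - c $ i) > 0" for z
        using that unfolding t_def by (auto simp: sgn_if zero_less_mult_iff mult_le_0_iff)
      have "t \<in> ?A" "t \<in> ?B"
        using coords_between[OF cx, of c x t i] coords_between[OF cy, of c y t i] t s in_X True by auto
      then have "{c $ i, t} \<subseteq> ?A \<inter> ?B" using True by auto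
      moreover have "card {c $ i, t} = 2" using s unfolding t_def by (auto simp: sgn_if)
      ultimately show ?thesis using True fin by (metis (lifting) card_mono finite_Int finite_imageI finite_insert)
    next
      case False
      have "{c $ j} \<subseteq> ?A \<inter> ?B" by auto
      then have "card {c $ j} \<le> card (?A \<inter> ?B)" using fin by (intro card_mono) auto
      then show ?thesis using False by simp
    qed
    ultimately show ?thesis by simp
  qed
  then have "(\<Sum>j\<in>UNIV. card (coords j (insert c X \<union> insert c Y)) + (if j = i then 2 else 1))
      \<le> (\<Sum>j\<in>UNIV. card (coords j (insert c X)) + card (coords j (insert c Y)))"
    by (rule sum_mono)
  \<comment> \<open>Two shared values along \<open>i\<close> and one along each other axis make
    four. Three would fit the counts, as \<open>c\<close> is shared; the fourth is the
    contradiction.\<close>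
  moreover have "(\<Sum>j\<in>(UNIV :: 3 set). if j = i then 2 else 1) = (4::nat)"
    by (subst sum.If_cases) (auto simp: Compl_eq_Diff_UNIV card_Diff_subset)
  ultimately have "card (insert c X \<union> insert c Y) + 2 + 4 \<le> card (insert c X) + 2 + (card (insert c Y) + 2)"
    unfolding cardXY cardX cardY by (simp add: sum.distrib)
  moreover have "card (insert c X \<union> insert c Y) = card X + card Y + 1"
  proof -
    have "insert c X \<union> insert c Y = insert c (X \<union> Y)" by blast
    moreover have "c \<notin> X \<union> Y" using sub by blast
    ultimately show ?thesis using fin XY by (simp add: card_Un_disjoint)
  qed
  moreover have "c \<notin> X" "c \<notin> Y" using sub by auto
  then have "card (insert c X) = card X + 1" "card (insert c Y) = card Y + 1"
    using fin by auto
  ultimately show False by linarith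
qed

text \<open>Two different neighbours of \<open>c\<close> have \<open>c\<close> between them in every
  coordinate. If a component contained both, adding \<open>c\<close> would add a cell but no
  coordinate value, against equality for connected parts.\<close>

lemma unique_neighbour:
  assumes c: "c \<in> P" and d: "d \<in> P" "adjacent c d" and e: "e \<in> P" "adjacent c e"
    and de: "e \<in> component (P - {c}) d"
  shows "e = d"
proof (rule ccontr)
  assume neq: "e \<noteq> d"
  define X where "X = component (P - {c}) d"
  have dX: "d \<in> X" "e \<in> X" unfolding X_def using de component_self by auto
  have dc: "d \<noteq> c" using d adjacent_neq by blast
  have sub: "X \<subseteq> P - {c}" unfolding X_def using component_subset[of d "P - {c}"] d dc by blast
  have fin: "finite X" by (rule finite_subset[OF sub]) (simp add: finite)
  have cX: "face_connected X" unfolding X_def using face_connected_comp[of d "P - {c}"] d dc by blast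
  have ccX: "face_connected (insert c X)"
    unfolding X_def by (rule component_insert_connected[OF c d(1) dc])
  obtain i s where i: "s = 1 \<or> s = -1" "d $ i = c $ i + s" "\<And>j. j \<noteq> i \<Longrightarrow> d $ j = c $ j"
    using adjacentE[OF d(2)] by metis
  obtain k r where k: "r = 1 \<or> r = -1" "e $ k = c $ k + r" "\<And>j. j \<noteq> k \<Longrightarrow> e $ j = c $ j"
    using adjacentE[OF e(2)] by metis
  have "i = k \<Longrightarrow> r \<noteq> s" using neq i k by (metis vec_eq_iff)
  then have between: "(c $ j - d $ j) * (c $ j - e $ j) \<le> 0" for j
    using i k by (cases "j = i"; cases "j = k") auto
  have "c $ j \<in> coords j X" for j
    using coords_between[OF cX dX between] .
  then have "coords j (insert c X) = coords j X" for j by (simp add: insert_absorb)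
  then have "card (insert c X) + 2 = card X + 2"
    using card_connected[OF _ _ ccX] card_connected[OF _ _ cX] sub c dX by fastforce
  moreover have "c \<notin> X" using sub by blast
  ultimately show False using fin by simp
qed

section \<open>Cutting along an edge\<close>

text \<open>Every edge is a bridge: a walk from \<open>c\<close> that avoids \<open>d\<close> and
  still reaches a cell beyond \<open>d\<close> would leave \<open>c\<close> for the last time
  through a second neighbour in the component of \<open>d\<close>.\<close>

lemma edge_disjoint:
  assumes c: "c \<in> P" and d: "d \<in> P" "adjacent c d"
  shows "component (P - {c}) d \<inter> component (P - {d}) c = {}"
proof (rule ccontr)
  assume "\<not> ?thesis"
  then obtain x where x: "x \<in> component (P - {c}) d" "x \<in> component (P - {d}) c" by blast
  have dc: "d \<noteq> c" using d adjacent_neq by blast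
  then have "x \<noteq> c" using component_subset[of d "P - {c}"] x d by blast
  then obtain e where e: "e \<in> P - {d}" "adjacent c e" "x \<in> component (P - {d} - {c}) e"
    using component_exit[OF x(2)] by blast
  have "x \<in> component (P - {c}) e" using component_mono[of "P - {d} - {c}" "P - {c}"] e by blast
  then have "e \<in> component (P - {c}) d" using x component_sym component_trans by blast
  then show False using unique_neighbour[OF c d] e by blast
qed

lemma edge_cover:
  assumes c: "c \<in> P" and d: "d \<in> P" "adjacent c d"
  shows "component (P - {c}) d \<union> component (P - {d}) c = P"
proof
  have dc: "d \<noteq> c" using d adjacent_neq by blast
  have sub: "component (P - {c}) d \<subseteq> P - {c}" "component (P - {d}) c \<subseteq> P - {d}"
    using component_subset[of d "P - {c}"] component_subset[of c "P - {d}"] dc c d by auto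
  then show "component (P - {c}) d \<union> component (P - {d}) c \<subseteq> P" by blast
  show "P \<subseteq> component (P - {c}) d \<union> component (P - {d}) c"
  proof
    fix x assume "x \<in> P"
    then have "x \<in> component P c" using face_connectedD[OF conn] c by blast
    then show "x \<in> component (P - {c}) d \<union> component (P - {d}) c"
    proof (induction rule: component_induct)
      case base show ?case by (simp add: component_self)
    next
      case (step y z)
      show ?case
      proof (cases "z = c \<or> z = d")
        case True then show ?thesis using component_self by blast
      next
        case False
        then show ?thesis using step component_step[of y "P - {c}" d z]
          component_step[of y "P - {d}" c z] sub by blast
      qed
    qed
  qed
qed

text \<open>A cell beyond \<open>d\<close> that lies back in the direction of \<open>c\<close>
  would, by separation at \<open>d\<close>, be on the same side of the edge as
  \<open>c\<close>.\<close>

lemma edge_side: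
  assumes c: "c \<in> P" and d: "d \<in> P" "adjacent c d" and x: "x \<in> component (P - {c}) d"
  shows "(x $ i - d $ i) * (d $ i - c $ i) \<ge> 0"
proof (rule ccontr)
  assume neg: "\<not> ?thesis"
  obtain k s where k: "s = 1 \<or> s = -1" "d $ k = c $ k + s" "\<And>j. j \<noteq> k \<Longrightarrow> d $ j = c $ j"
    using adjacentE[OF d(2)] by metis
  have "i = k" using neg k(3)[of i] by (cases "i = k") auto
  have xP: "x \<in> P" using x component_subset[of d "P - {c}"] d adjacent_neq by blast
  have "c \<in> component (P - {d}) x"
    using separation[OF d(1) xP c, of "-s" k] neg k \<open>i = k\<close> by auto
  then show False using edge_disjoint[OF c d] x component_sym by blast
qed

text \<open>The opposite corner takes along each axis the extreme value on the side of
  \<open>d\<close> where \<open>C\<close> lies; minimality is inherited from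
  \<open>P\<close>.\<close>

lemma corner_inscribed:
  assumes C: "C \<subseteq> P" "face_connected C" "d \<in> C"
    and orth: "\<And>i. \<exists>s. s \<noteq> 0 \<and> (\<forall>x\<in>C. s * (x $ i - d $ i) \<ge> 0)"
  shows "\<exists>d'. minimal_inscribed d d' C"
proof -
  have fin: "finite C" using C finite finite_subset by blast
  have "\<exists>m\<in>coords i C. \<forall>x\<in>C. min (d $ i) m \<le> x $ i \<and> x $ i \<le> max (d $ i) m" for i
  proof -
    obtain s where s: "s \<noteq> 0" "\<forall>x\<in>C. s * (x $ i - d $ i) \<ge> 0" using orth by blast
    show ?thesis
    proof (cases "s > 0")
      case True
      then have "\<forall>x\<in>C. d $ i \<le> x $ i" using s by (simp add: zero_le_mult_iff)
      moreover have "Max (coords i C) \<in> coords i C" using fin C by (intro Max_in) auto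
      ultimately show ?thesis using fin by (intro bexI[of _ "Max (coords i C)"]) (auto simp: le_max_iff_disj min_le_iff_disj)
    next
      case False
      then have "\<forall>x\<in>C. x $ i \<le> d $ i" using s by (auto simp: zero_le_mult_iff)
      moreover have "Min (coords i C) \<in> coords i C" using fin C by (intro Min_in) auto
      ultimately show ?thesis using fin by (intro bexI[of _ "Min (coords i C)"]) (auto simp: le_max_iff_disj min_le_iff_disj)
    qed
  qed
  then have "\<forall>i. \<exists>m. m \<in> coords i C \<and> (\<forall>x\<in>C. min (d $ i) m \<le> x $ i \<and> x $ i \<le> max (d $ i) m)"
    by blast
  from choice[OF this] obtain m where m: "\<And>i. m i \<in> coords i C"
    "\<And>i x. x \<in> C \<Longrightarrow> min (d $ i) (m i) \<le> x $ i \<and> x $ i \<le> max (d $ i) (m i)" by blast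
  have "C \<subseteq> Box d (\<chi> i. m i)" unfolding Box_def using m(2) by auto
  moreover have "\<exists>x\<in>C. x $ i = d $ i" "\<exists>x\<in>C. x $ i = (\<chi> i. m i) $ i" for i
    using C(3) m(1)[of i] by auto
  ultimately have "inscribed d (\<chi> i. m i) C" unfolding inscribed_def by blast
  then show ?thesis using minimal_inscribedI[OF C(1) _ C(2)] C(3) by blast
qed

end

subsection \<open>Directions at a cell\<close>

text \<open>
  Read \<open>L i s j t\<close> as: the directions \<open>s\<close> along axis \<open>i\<close> and \<open>t\<close> along axis \<open>j\<close> occur in the same
  component. Below \<open>q a i j\<close> says that axes \<open>i\<close> and \<open>j\<close> are linked with relative sign \<open>a\<close>; no choice of
  signs fits exactly if all three pairs of axes are linked and the relative signs multiply to \<open>-1\<close>.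
\<close>

lemma cyclic_links:
  fixes L :: "3 \<Rightarrow> int \<Rightarrow> 3 \<Rightarrow> int \<Rightarrow> bool"
  assumes sym: "\<And>i s j t. L i s j t \<Longrightarrow> L j t i s"
    and trans: "\<And>i s j t k r. L i s j t \<Longrightarrow> L j t k r \<Longrightarrow> L i s k r"
    and opp: "\<And>i s. \<not> L i s i (-s)"
    and fail: "\<And>\<sigma>. (\<And>i. \<sigma> i = 1 \<or> \<sigma> i = -1) \<Longrightarrow> \<exists>i j. L i (\<sigma> i) j (- \<sigma> j)"
  obtains s1 s2 s3 where "s1 = 1 \<or> s1 = -1" "s2 = 1 \<or> s2 = -1" "s3 = 1 \<or> s3 = -1"
    "L 1 s1 2 s2" "L 2 (-s2) 3 s3" "L 3 (-s3) 1 (-s1)"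
proof -
  define q where "q a i j \<longleftrightarrow> L i 1 j a \<or> L i (-1) j (-a)" for a i j
  have excl: "\<not> (q a i j \<and> q (-a) i j)" for a i j
    unfolding q_def using sym trans opp by (metis minus_minus)
  have any: "q (-a) 1 2 \<or> q (-b) 2 3 \<or> q (-(a * b)) 1 3"
    if a: "a = 1 \<or> a = -1" and b: "b = 1 \<or> b = -1" for a b
  proof -
    \<comment> \<open>Only relative signs matter, so axis 1 gets sign 1; \<open>a\<close> and
      \<open>b\<close> are the relative signs of axes 1, 2 and of axes 2, 3.\<close>
    define \<sigma> :: "3 \<Rightarrow> int" where "\<sigma> i = (if i = 1 then 1 else if i = 2 then a else a * b)" for i
    have \<sigma>: "\<sigma> 1 = 1" "\<sigma> 2 = a" "\<sigma> 3 = a * b" unfolding \<sigma>_def by auto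
    have "\<sigma> i = 1 \<or> \<sigma> i = -1" for i using a b unfolding \<sigma>_def by auto
    then obtain i j where ij: "L i (\<sigma> i) j (- \<sigma> j)" using fail by blast
    then have "L j (- \<sigma> j) i (\<sigma> i)" by (rule sym)
    moreover have "i \<noteq> j" using ij opp by blast
    ultimately show ?thesis
      using ij exhaust_3[of i] exhaust_3[of j] a b \<sigma> unfolding q_def by auto
  qed
  have "q (-1) 1 2 \<or> q (-1) 2 3 \<or> q (-1) 1 3" "q (-1) 1 2 \<or> q 1 2 3 \<or> q 1 1 3"
    "q 1 1 2 \<or> q (-1) 2 3 \<or> q 1 1 3" "q 1 1 2 \<or> q 1 2 3 \<or> q (-1) 1 3"
    using any[of 1 1] any[of 1 "-1"] any[of "-1" 1] any[of "-1" "-1"] by simp_all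
  \<comment> \<open>One clause for each choice of relative signs. As a pair of axes has at most one
    relative sign, the clauses force all three pairs to be linked, with product -1.\<close>
  then have "q 1 1 2 \<and> q 1 2 3 \<and> q (-(1 * 1)) 1 3 \<or> q 1 1 2 \<and> q (-1) 2 3 \<and> q (-(1 * -1)) 1 3 \<or>
      q (-1) 1 2 \<and> q 1 2 3 \<and> q (-(-1 * 1)) 1 3 \<or> q (-1) 1 2 \<and> q (-1) 2 3 \<and> q (-(-1 * -1)) 1 3"
    using excl[of 1 1 2] excl[of 1 2 3] excl[of 1 1 3] by simp blast
  then obtain a b where a: "a = 1 \<or> a = -1" and b: "b = 1 \<or> b = -1"
    and q: "q a 1 2" "q b 2 3" "q (-(a * b)) 1 3" by metis
  have ex: "\<exists>s. (s = 1 \<or> s = -1) \<and> L i s j (a * s)" if "q a i j" for a i j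
    using that unfolding q_def by (metis mult.right_neutral mult_minus_right)
  obtain s where s: "s = 1 \<or> s = -1" "L 1 s 2 (a * s)" using ex[OF q(1)] by blast
  obtain r where r: "r = 1 \<or> r = -1" "L 2 r 3 (b * r)" using ex[OF q(2)] by blast
  obtain t where t: "t = 1 \<or> t = -1" "L 1 t 3 (- (a * b) * t)" using ex[OF q(3)] by blast
  note srt = s(1) r(1) t(1) and L = s(2) r(2) t(2)
  \<comment> \<open>If the first two links met in the same direction of axis 2, they would chain to
    a link of axes 1 and 3 with relative sign \<open>a * b\<close>, which clashes with the third
    link.\<close>
  have r: "r = - (a * s)"
  proof (rule ccontr)
    assume "r \<noteq> - (a * s)"
    then have "r = a * s" using srt a by auto
    then have 1: "L 1 s 3 (a * b * s)" using trans[OF L(1), of 3 "b * r"] L(2) by (simp add: ac_simps)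
    have "t = s \<or> t = - s" using srt by auto
    then show False
    proof
      assume "t = s"
      then have "L 1 s 3 (- (a * b * s))" using L(3) by simp
      then show False using trans[OF sym[OF 1]] opp by blast
    next
      assume "t = - s"
      then have "L 1 (- s) 3 (a * b * s)" using L(3) by simp
      then show False using trans[OF 1 sym] opp by blast
    qed
  qed
  then have 2: "L 2 (- (a * s)) 3 (- (a * b * s))" using L(2) by (simp add: ac_simps)
  have "t = - s"
  proof (rule ccontr)
    assume "t \<noteq> - s"
    then have "t = s" using srt by auto
    then have "L 1 s 3 (- (a * b * s))" using L(3) by simp
    then have "L 2 (a * s) 3 (- (a * b * s))" using trans[OF sym[OF L(1)]] by blast
    then show False using trans[OF _ sym[OF 2]] opp by blast
  qed
  then have "L 3 (a * b * s) 1 (- s)" using sym[OF L(3)] by simp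
  then show ?thesis using that[of s "a * s" "- (a * b * s)"] L(1) 2 srt(1) a b by auto
qed

lemma distinct_3_cases:
  fixes i j k :: 3
  assumes "distinct [i, j, k]"
  shows "l = i \<or> l = j \<or> l = k"
  using assms exhaust_3[of i] exhaust_3[of j] exhaust_3[of k] exhaust_3[of l] by auto

context minimal_polyomino
begin

text \<open>Only the signs of \<open>s\<close> and \<open>t\<close> matter, so a coordinate
  difference can serve as a direction.\<close>

definition linked :: "cell \<Rightarrow> 3 \<Rightarrow> int \<Rightarrow> 3 \<Rightarrow> int \<Rightarrow> bool" where
  "linked c i s j t \<longleftrightarrow>
     (\<exists>x\<in>P. \<exists>y\<in>component (P - {c}) x. s * (x $ i - c $ i) > 0 \<and> t * (y $ j - c $ j) > 0)"

definition two_sided :: "cell \<Rightarrow> bool" where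
  "two_sided c \<longleftrightarrow> (\<exists>i. linked c i 1 i (-1))"

definition coherent :: "cell \<Rightarrow> (3 \<Rightarrow> int) \<Rightarrow> bool" where
  "coherent c \<sigma> \<longleftrightarrow> (\<forall>i j. \<not> linked c i (\<sigma> i) j (- \<sigma> j))"

definition skew_centre :: "cell \<Rightarrow> bool" where
  "skew_centre c \<longleftrightarrow> (\<exists>s1 s2 s3. (s1 = 1 \<or> s1 = -1) \<and> (s2 = 1 \<or> s2 = -1) \<and> (s3 = 1 \<or> s3 = -1) \<and>
     linked c 1 s1 2 s2 \<and> linked c 2 (-s2) 3 s3 \<and> linked c 3 (-s3) 1 (-s1))"

lemma component_sub: "x \<in> P \<Longrightarrow> x \<noteq> c \<Longrightarrow> component (P - {c}) x \<subseteq> P - {c}"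
  using component_subset[of x "P - {c}"] by blast

lemma linked_sym:
  assumes "linked c i s j t" shows "linked c j t i s"
proof -
  obtain x y where xy: "x \<in> P" "y \<in> component (P - {c}) x" "s * (x $ i - c $ i) > 0" "t * (y $ j - c $ j) > 0"
    using assms unfolding linked_def by blast
  have "x \<noteq> c" using xy(3) by auto
  then have "y \<in> P" using component_sub[of x c] xy by blast
  then show ?thesis unfolding linked_def using xy component_sym[OF xy(2)] by blast
qed

text \<open>Both links use the direction \<open>t\<close> along \<open>j\<close>, and by separation
  all cells in that direction share a component.\<close>

lemma linked_trans:
  assumes "c \<in> P" "linked c i s j t" "linked c j t k r"
  shows "linked c i s k r"
proof -
  obtain x y where xy: "x \<in> P" "y \<in> component (P - {c}) x" "s * (x $ i - c $ i) > 0" "t * (y $ j - c $ j) > 0"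
    using assms unfolding linked_def by blast
  obtain x' y' where xy': "x' \<in> P" "y' \<in> component (P - {c}) x'" "t * (x' $ j - c $ j) > 0" "r * (y' $ k - c $ k) > 0"
    using assms unfolding linked_def by blast
  have "x \<noteq> c" using xy(3) by auto
  then have "y \<in> P" using component_sub[of x c] xy by blast
  then have "x' \<in> component (P - {c}) y" using separation assms xy xy' by blast
  then have "y' \<in> component (P - {c}) x" using xy(2) xy'(2) component_trans by metis
  then show ?thesis unfolding linked_def using xy xy' by blast
qed

lemma two_sidedI: "linked c i s i (-s) \<Longrightarrow> two_sided c"
proof -
  assume l: "linked c i s i (-s)"
  then obtain x y where xy: "x \<in> P" "y \<in> component (P - {c}) x" "s * (x $ i - c $ i) > 0" "- s * (y $ i - c $ i) > 0"
    unfolding linked_def by blast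
  show ?thesis
  proof (cases "s > 0")
    case True
    then have "linked c i 1 i (-1)" using xy unfolding linked_def
      by (intro bexI[of _ x] bexI[of _ y]) (auto simp: zero_less_mult_iff mult_less_0_iff)
    then show ?thesis unfolding two_sided_def by blast
  next
    case False
    then have "linked c i (-1) i 1" using xy unfolding linked_def
      by (intro bexI[of _ x] bexI[of _ y]) (auto simp: zero_less_mult_iff mult_less_0_iff)
    then show ?thesis unfolding two_sided_def using linked_sym by blast
  qed
qed

lemma cell_cases:
  assumes "c \<in> P"
  obtains "two_sided c"
    | \<sigma> where "\<And>i. \<sigma> i = 1 \<or> \<sigma> i = -1" "coherent c \<sigma>"
    | "\<not> two_sided c" "skew_centre c"
proof (cases "two_sided c \<or> (\<exists>\<sigma>. (\<forall>i. \<sigma> i = 1 \<or> \<sigma> i = -1) \<and> coherent c \<sigma>)")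
  case True then show ?thesis using that by blast
next
  case False
  have "\<exists>i j. linked c i (\<sigma> i) j (- \<sigma> j)" if "\<And>i. \<sigma> i = 1 \<or> \<sigma> i = -1" for \<sigma>
    using False that unfolding coherent_def by blast
  moreover have "\<not> linked c i s i (-s)" for i s using False two_sidedI by blast
  ultimately have "skew_centre c"
    using cyclic_links[of "linked c"] linked_sym linked_trans[OF assms]
    unfolding skew_centre_def by (smt (verit, ccfv_threshold))
  then show ?thesis using that False by blast
qed

lemma component_has_neighbour:
  assumes "c \<in> P" "x \<in> P" "x \<noteq> c"
  obtains d where "d \<in> P" "adjacent c d" "x \<in> component (P - {c}) d"
proof -
  have "x \<in> component P c" using face_connectedD[OF conn] assms by blast
  from component_exit[OF this assms(3)] show ?thesis using that by blast
qed

end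

subsection \<open>Skew crosses\<close>

text \<open>Two neighbours on the same axis are opposite; otherwise each axis carries one neighbour
  and the contact faces share a vertex.\<close>

lemma three_neighbours_type:
  assumes "adjacent c d1" "adjacent c d2" "adjacent c d3" "distinct [d1, d2, d3]"
  shows "type_a c d1 d2 d3 \<or> type_b c d1 d2 d3"
proof -
  obtain i1 s1 where 1: "s1 = 1 \<or> s1 = -1" "d1 $ i1 = c $ i1 + s1" "\<And>j. j \<noteq> i1 \<Longrightarrow> d1 $ j = c $ j"
    using adjacentE[OF assms(1)] by metis
  obtain i2 s2 where 2: "s2 = 1 \<or> s2 = -1" "d2 $ i2 = c $ i2 + s2" "\<And>j. j \<noteq> i2 \<Longrightarrow> d2 $ j = c $ j"
    using adjacentE[OF assms(2)] by metis
  obtain i3 s3 where 3: "s3 = 1 \<or> s3 = -1" "d3 $ i3 = c $ i3 + s3" "\<And>j. j \<noteq> i3 \<Longrightarrow> d3 $ j = c $ j"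
    using adjacentE[OF assms(3)] by metis
  have opp: "opposite_neighbours c d e"
    if "d \<noteq> e" "s = 1 \<or> s = -1" "d $ i = c $ i + s" "\<And>j. j \<noteq> i \<Longrightarrow> d $ j = c $ j"
      "t = 1 \<or> t = -1" "e $ i = c $ i + t" "\<And>j. j \<noteq> i \<Longrightarrow> e $ j = c $ j" for d e i s t
  proof -
    have "s \<noteq> t" using that by (metis vec_eq_iff)
    then have "(d - c) $ j = (c - e) $ j" for j using that by (cases "j = i") auto
    then show ?thesis unfolding opposite_neighbours_def by (simp add: vec_eq_iff)
  qed
  show ?thesis
  proof (cases "i1 = i2 \<or> i1 = i3 \<or> i2 = i3")
    case True
    then show ?thesis
      using opp[OF _ 1, of d2 s2] opp[OF _ 1, of d3 s3] opp[OF _ 2, of d3 s3] 2 3 assms(4)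
      unfolding type_a_def by auto
  next
    case False
    \<comment> \<open>The lowest vertex of \<open>c\<close>, moved up along those axes whose
      neighbour lies in the positive direction.\<close>
    define v :: cell where
      "v = (\<chi> l. if d1 $ l = c $ l + 1 \<or> d2 $ l = c $ l + 1 \<or> d3 $ l = c $ l + 1 then c $ l + 1 else c $ l)"
    have v: "v $ l = (if d1 $ l = c $ l + 1 \<or> d2 $ l = c $ l + 1 \<or> d3 $ l = c $ l + 1 then c $ l + 1 else c $ l)" for l
      unfolding v_def by simp
    have l: "l = i1 \<or> l = i2 \<or> l = i3" for l using distinct_3_cases[of i1 i2 i3 l] False by auto
    have "(v $ l = c $ l \<or> v $ l = c $ l + 1) \<and> (v $ l = d1 $ l \<or> v $ l = d1 $ l + 1) \<and>
        (v $ l = d2 $ l \<or> v $ l = d2 $ l + 1) \<and> (v $ l = d3 $ l \<or> v $ l = d3 $ l + 1)" for l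
      using l[of l] v[of l] 1(1,2) 1(3)[of l] 2(1,2) 2(3)[of l] 3(1,2) 3(3)[of l] False by auto
    then have "v \<in> vertices c \<inter> vertices d1 \<inter> vertices d2 \<inter> vertices d3"
      unfolding vertices_def by blast
    then show ?thesis unfolding type_b_def by blast
  qed
qed

lemma extent_ge_2:
  assumes "finite Q" "e \<in> Q"
  shows "extent j Q \<ge> 2 \<longleftrightarrow> (\<exists>x\<in>Q. x $ j \<noteq> e $ j)"
proof
  assume ext: "extent j Q \<ge> 2"
  show "\<exists>x\<in>Q. x $ j \<noteq> e $ j"
  proof (rule ccontr)
    assume "\<not> ?thesis"
    then have "coords j Q = (\<lambda>_. e $ j) ` Q" by (intro image_cong) auto
    then have "coords j Q = {e $ j}" using assms(2) by (simp add: image_constant)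
    then show False using ext unfolding extent_def by simp
  qed
next
  assume "\<exists>x\<in>Q. x $ j \<noteq> e $ j"
  then obtain x where x: "x \<in> Q" "x $ j \<noteq> e $ j" by blast
  have "Min (coords j Q) \<le> y $ j \<and> y $ j \<le> Max (coords j Q)" if "y \<in> Q" for y
    using that assms(1) by auto
  from this[OF x(1)] this[OF assms(2)] x(2) show "extent j Q \<ge> 2"
    unfolding extent_def by linarith
qed

text \<open>Describes the arm relative to \<open>c\<close> instead of \<open>d\<close> and without
  naming \<open>i\<close> and \<open>j\<close>, so that the three arms can be treated alike.\<close>

lemma skew_armD:
  assumes "skew_arm c d n Q" "adjacent c d"
  shows "face_connected Q" "d \<in> Q" "\<And>x. x \<in> Q \<Longrightarrow> x $ n = c $ n"
    "\<And>x y l. x \<in> Q \<Longrightarrow> y \<in> Q \<Longrightarrow> (x $ l - c $ l) * (y $ l - c $ l) \<ge> 0"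
    "\<And>l. l \<noteq> n \<Longrightarrow> \<exists>x\<in>Q. x $ l \<noteq> c $ l"
proof -
  from assms(1) obtain i j d' where ij: "distinct [n, i, j]" "on_line i c d"
      "\<forall>x\<in>Q. (x $ i - d $ i) * (d $ i - c $ i) \<ge> 0" "extent j Q \<ge> 2"
    and Q: "Q \<subseteq> layer n (d $ n)" "d \<in> Q" "minimal_inscribed d d' Q"
    unfolding skew_arm_def planar_corner_def by blast
  have off: "d $ l = c $ l" if "l \<noteq> i" for l using ij(2) that unfolding on_line_def by auto
  have di: "d $ i \<noteq> c $ i"
    using adjacent_neq[OF assms(2)] off by (metis vec_eq_iff)
  show "face_connected Q" "d \<in> Q"
    using Q unfolding minimal_inscribed_def polyomino_def by auto
  show n: "x $ n = c $ n" if "x \<in> Q" for x using that Q(1) off[of n] ij(1) by (auto simp: layer_def)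
  have box: "min (d $ l) (d' $ l) \<le> x $ l" "x $ l \<le> max (d $ l) (d' $ l)" if "x \<in> Q" for x l
    using that Q(3) unfolding minimal_inscribed_def inscribed_def Box_def by auto
  show "(x $ l - c $ l) * (y $ l - c $ l) \<ge> 0" if xy: "x \<in> Q" "y \<in> Q" for x y l
  proof -
    consider "l = n" | "l = i" | "l = j" using distinct_3_cases[OF ij(1)] by blast
    then show ?thesis
    proof cases
      case 1 then show ?thesis using n xy by simp
    next
      case 2
      have "(x $ i - d $ i) * (d $ i - c $ i) \<ge> 0" "(y $ i - d $ i) * (d $ i - c $ i) \<ge> 0"
        using ij(3) xy by auto
      then show ?thesis using di 2 by (auto simp: zero_le_mult_iff)
    next
      case 3
      then have "d $ l = c $ l" using off[of l] ij(1) by auto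
      then show ?thesis using box[OF xy(1), of l] box[OF xy(2), of l]
        by (cases "d $ l \<le> d' $ l") (auto simp: zero_le_mult_iff)
    qed
  qed
  show "\<exists>x\<in>Q. x $ l \<noteq> c $ l" if "l \<noteq> n" for l
  proof -
    have "l = i \<or> l = j" using distinct_3_cases[OF ij(1)] that by blast
    then consider "l = i" | "l = j" by blast
    then show ?thesis
    proof cases
      case 1 then show ?thesis using di Q(2) by blast
    next
      case 2
      have "finite Q" using Q(3) unfolding minimal_inscribed_def polyomino_def by blast
      then have "\<exists>x\<in>Q. x $ j \<noteq> d $ j" using extent_ge_2 Q(2) ij(4) by blast
      then show ?thesis using off[of j] ij(1) 2 by auto
    qed
  qed
qed

context minimal_polyomino
begin

text \<open>The component is flat along \<open>n\<close>, stays beyond \<open>d\<close> along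
  \<open>i\<close> by \<open>edge_side\<close>, and is one-sided along \<open>j\<close>; hence
  \<open>d\<close> is a corner of it.\<close>

lemma skew_arm_component:
  assumes c: "c \<in> P" and d: "d \<in> P" "adjacent c d" and n: "distinct [n, i, j]" "on_line i c d"
    and plane: "\<And>x. x \<in> component (P - {c}) d \<Longrightarrow> x $ n = c $ n"
    and t: "t \<noteq> 0" "\<And>x. x \<in> component (P - {c}) d \<Longrightarrow> t * (x $ j - c $ j) \<ge> 0"
    and y: "y \<in> component (P - {c}) d" "y $ j \<noteq> c $ j"
  shows "skew_arm c d n (component (P - {c}) d)"
proof -
  let ?Q = "component (P - {c}) d"
  have dc: "d \<noteq> c" using adjacent_neq d by blast
  have sub: "?Q \<subseteq> P - {c}" using component_sub d dc by blast
  have cq: "face_connected ?Q" using face_connected_comp[of d "P - {c}"] d dc by blast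
  have fin: "finite ?Q" by (rule finite_subset[OF sub]) (simp add: finite)
  have off: "d $ l = c $ l" if "l \<noteq> i" for l using n(2) that unfolding on_line_def by auto
  have di: "d $ i \<noteq> c $ i" using dc off by (metis vec_eq_iff)
  have "\<exists>s. s \<noteq> 0 \<and> (\<forall>x\<in>?Q. s * (x $ l - d $ l) \<ge> 0)" for l
  proof -
    consider "l = n" | "l = i" | "l = j" using distinct_3_cases[OF n(1)] by blast
    then show ?thesis
    proof cases
      case 1 then show ?thesis using plane off[of n] n(1) by (intro exI[of _ 1]) auto
    next
      case 2 then show ?thesis using edge_side[OF c d, of _ i] di
        by (intro exI[of _ "d $ i - c $ i"]) (auto simp: mult.commute)
    next
      case 3 then show ?thesis using t off[of j] n(1) by (intro exI[of _ t]) auto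
    qed
  qed
  then have "\<exists>d'. minimal_inscribed d d' ?Q"
    using corner_inscribed[of ?Q d] sub cq component_self[of d] by blast
  then have "planar_corner n d ?Q"
    unfolding planar_corner_def layer_def using plane off[of n] n(1) component_self by auto
  moreover have "\<exists>x\<in>?Q. x $ j \<noteq> d $ j" using y off[of j] n(1) by auto
  then have "extent j ?Q \<ge> 2" using extent_ge_2[OF fin component_self] by blast
  moreover have "\<forall>x\<in>?Q. (x $ i - d $ i) * (d $ i - c $ i) \<ge> 0" using edge_side[OF c d] by blast
  ultimately show ?thesis unfolding skew_arm_def using n by blast
qed

text \<open>The missing links to axis \<open>n\<close> make the component planar, and since
  \<open>c\<close> is not two-sided, it is one-sided along \<open>i\<close> and \<open>j\<close>.
  Separation shows that it contains every cell in its two directions.\<close>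

lemma linked_skew_arm:
  assumes c: "c \<in> P" and two: "\<not> two_sided c" and ij: "linked c i s j t"
    and st: "s = 1 \<or> s = -1" "t = 1 \<or> t = -1" and n: "distinct [n, i, j]"
    and no: "\<not> linked c i s n 1" "\<not> linked c i s n (-1)"
  obtains d where "d \<in> P" "adjacent c d" "skew_arm c d n (component (P - {c}) d)"
    "component (P - {c}) d = {x \<in> P. s * (x $ i - c $ i) > 0 \<or> t * (x $ j - c $ j) > 0}"
proof -
  obtain x y where xy: "x \<in> P" "y \<in> component (P - {c}) x" "s * (x $ i - c $ i) > 0" "t * (y $ j - c $ j) > 0"
    using ij unfolding linked_def by blast
  then have xc: "x \<noteq> c" by auto
  obtain d where d: "d \<in> P" "adjacent c d" "x \<in> component (P - {c}) d"
    using component_has_neighbour[OF c xy(1) xc] .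
  have dc: "d \<noteq> c" using adjacent_neq d by blast
  let ?Q = "component (P - {c}) d"
  have eq: "component (P - {c}) x = ?Q" using component_eq d(3) by blast
  have eq': "component (P - {c}) y = ?Q" using component_eq[OF xy(2)] eq by simp
  have sub: "?Q \<subseteq> P - {c}" using component_sub d dc by blast
  have yP: "y \<in> P" using xy eq sub by blast
  have lk: "z $ n = c $ n" "s * (z $ i - c $ i) \<ge> 0" "t * (z $ j - c $ j) \<ge> 0" if "z \<in> ?Q" for z
  proof -
    have zP: "z \<in> P" using that sub by blast
    have z: "z \<in> component (P - {c}) x" "z \<in> component (P - {c}) y"
      using that eq eq' by simp_all
    show "z $ n = c $ n"
    proof (rule ccontr)
      assume "z $ n \<noteq> c $ n"
      then have "1 * (z $ n - c $ n) > 0 \<or> -1 * (z $ n - c $ n) > 0" by auto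
      then show False using no xy(1,3) z(1) unfolding linked_def by blast
    qed
    show "s * (z $ i - c $ i) \<ge> 0"
    proof (rule ccontr)
      assume "\<not> ?thesis"
      then have "linked c i s i (-s)" unfolding linked_def using xy(1,3) z(1) by force
      then show False using two two_sidedI by blast
    qed
    show "t * (z $ j - c $ j) \<ge> 0"
    proof (rule ccontr)
      assume "\<not> ?thesis"
      then have "linked c j t j (-t)" unfolding linked_def using xy(4) yP z(2) by force
      then show False using two two_sidedI by blast
    qed
  qed
  have Q: "?Q = {x \<in> P. s * (x $ i - c $ i) > 0 \<or> t * (x $ j - c $ j) > 0}"
  proof (intro equalityI subsetI)
    fix z assume z: "z \<in> ?Q"
    then have "z \<noteq> c" "z \<in> P" using sub by auto
    then obtain l where "z $ l \<noteq> c $ l" by (metis vec_eq_iff)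
    then have "z $ i \<noteq> c $ i \<or> z $ j \<noteq> c $ j" using distinct_3_cases[OF n, of l] lk(1)[OF z] by metis
    then have "s * (z $ i - c $ i) \<noteq> 0 \<or> t * (z $ j - c $ j) \<noteq> 0" using st by auto
    then have "s * (z $ i - c $ i) > 0 \<or> t * (z $ j - c $ j) > 0"
      using lk(2,3)[OF z] by (metis order_le_less)
    then show "z \<in> {x \<in> P. s * (x $ i - c $ i) > 0 \<or> t * (x $ j - c $ j) > 0}"
      using \<open>z \<in> P\<close> by blast
  next
    fix z assume "z \<in> {x \<in> P. s * (x $ i - c $ i) > 0 \<or> t * (x $ j - c $ j) > 0}"
    then have "z \<in> component (P - {c}) x \<or> z \<in> component (P - {c}) y"
      using separation[OF c xy(1)] separation[OF c yP] xy(3,4) by blast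
    then show "z \<in> ?Q" using eq eq' by simp
  qed
  obtain k r where k: "r = 1 \<or> r = -1" "d $ k = c $ k + r" "\<And>l. l \<noteq> k \<Longrightarrow> d $ l = c $ l"
    using adjacentE[OF d(2)] by metis
  have line: "on_line k c d" unfolding on_line_def using k(3) by auto
  have "k \<noteq> n" using lk(1)[OF component_self] k(1,2) by auto
  then have "k = i \<or> k = j" using distinct_3_cases[OF n] by blast
  \<comment> \<open>The entry neighbour may lie on either axis of the plane; that axis then becomes
    the one through \<open>c\<close> and \<open>d\<close>.\<close>
  then have "skew_arm c d n ?Q"
  proof
    assume "k = i"
    have "y \<in> ?Q" "y $ j \<noteq> c $ j" using xy eq by auto
    then show ?thesis
      using skew_arm_component[OF c d(1,2) n _ lk(1), of t] lk(3) st line \<open>k = i\<close> by auto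
  next
    assume "k = j"
    have "distinct [n, j, i]" using n by auto
    have "x \<in> ?Q" "x $ i \<noteq> c $ i" using xy d by auto
    then show ?thesis
      using skew_arm_component[OF c d(1,2) \<open>distinct [n, j, i]\<close> _ lk(1), of s] lk(2) st line \<open>k = j\<close> by auto
  qed
  then show ?thesis using that d Q by blast
qed

lemma skew_centre_skew_cross:
  assumes min: "minimal_inscribed a b P" and c: "c \<in> P" and two: "\<not> two_sided c" and "skew_centre c"
  shows "skew_cross a b P"
proof -
  obtain s1 s2 s3 where s: "s1 = 1 \<or> s1 = -1" "s2 = 1 \<or> s2 = -1" "s3 = 1 \<or> s3 = -1"
    and l: "linked c 1 s1 2 s2" "linked c 2 (-s2) 3 s3" "linked c 3 (-s3) 1 (-s1)"
    using assms(4) unfolding skew_centre_def by blast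
  have s': "-s1 = 1 \<or> -s1 = -1" "-s2 = 1 \<or> -s2 = -1" "-s3 = 1 \<or> -s3 = -1" using s by auto
  have opp: "\<not> linked c i s i (-s)" "\<not> linked c i (-s) i s" for i s
    using two two_sidedI[of c i s] linked_sym[of c i "-s" i s] by blast+
  \<comment> \<open>Any link from direction \<open>s\<close> of \<open>i\<close> to the third axis
    closes up, around the cycle, to a link between opposite directions of \<open>j\<close> or of
    \<open>i\<close>.\<close>
  have no: "\<not> linked c i s k r \<and> \<not> linked c i s k (-r)"
    if "linked c i s j t" "linked c j (-t) k r" "linked c k (-r) i (-s)" for i s j t k r
  proof -
    have "\<not> linked c i s k r"
      using linked_trans[OF c linked_trans[OF c that(2) linked_sym] that(1)] opp by blast
    moreover have "\<not> linked c i s k (-r)" using linked_trans[OF c _ that(3)] opp by blast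
    ultimately show ?thesis by blast
  qed
  have "\<not> linked c 1 s1 3 s3 \<and> \<not> linked c 1 s1 3 (-s3)" using no[OF l] .
  moreover have "\<not> linked c 2 (-s2) 1 (-s1) \<and> \<not> linked c 2 (-s2) 1 s1"
    using no[OF l(2,3)] l(1) by simp
  moreover have "\<not> linked c 3 (-s3) 2 s2 \<and> \<not> linked c 3 (-s3) 2 (-s2)"
    using no[OF l(3), of 2 s2] l(1,2) by simp
  ultimately have no: "\<not> linked c 1 s1 3 1" "\<not> linked c 1 s1 3 (-1)"
    "\<not> linked c 2 (-s2) 1 1" "\<not> linked c 2 (-s2) 1 (-1)"
    "\<not> linked c 3 (-s3) 2 1" "\<not> linked c 3 (-s3) 2 (-1)"
    using s by auto
  obtain d1 where d1: "d1 \<in> P" "adjacent c d1" "skew_arm c d1 3 (component (P - {c}) d1)"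
    "component (P - {c}) d1 = {x \<in> P. s1 * (x $ 1 - c $ 1) > 0 \<or> s2 * (x $ 2 - c $ 2) > 0}"
    using linked_skew_arm[OF c two l(1) s(1,2) _ no(1,2)] by auto
  obtain d2 where d2: "d2 \<in> P" "adjacent c d2" "skew_arm c d2 1 (component (P - {c}) d2)"
    "component (P - {c}) d2 = {x \<in> P. -s2 * (x $ 2 - c $ 2) > 0 \<or> s3 * (x $ 3 - c $ 3) > 0}"
    using linked_skew_arm[OF c two l(2) s'(2) s(3) _ no(3,4)] by auto
  obtain d3 where d3: "d3 \<in> P" "adjacent c d3" "skew_arm c d3 2 (component (P - {c}) d3)"
    "component (P - {c}) d3 = {x \<in> P. -s3 * (x $ 3 - c $ 3) > 0 \<or> -s1 * (x $ 1 - c $ 1) > 0}"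
    using linked_skew_arm[OF c two l(3) s'(3,1) _ no(5,6)] by auto
  define Q1 where "Q1 = component (P - {c}) d1"
  define Q2 where "Q2 = component (P - {c}) d2"
  define Q3 where "Q3 = component (P - {c}) d3"
  have in_Q: "d1 \<in> Q1" "d2 \<in> Q2" "d3 \<in> Q3" unfolding Q1_def Q2_def Q3_def by (auto intro: component_self)
  have plane: "x \<in> Q1 \<Longrightarrow> x $ 3 = c $ 3" "x \<in> Q2 \<Longrightarrow> x $ 1 = c $ 1" "x \<in> Q3 \<Longrightarrow> x $ 2 = c $ 2" for x
    unfolding Q1_def Q2_def Q3_def
    using skew_armD(3)[OF d1(3,2)] skew_armD(3)[OF d2(3,2)] skew_armD(3)[OF d3(3,2)] by auto
  \<comment> \<open>Each of the six strict inequalities relative to \<open>c\<close> belongs to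
    exactly one arm, so disjointness and covering become sign checks.\<close>
  have desc: "x \<in> Q1 \<longleftrightarrow> x \<in> P \<and> (s1 * (x $ 1 - c $ 1) > 0 \<or> s2 * (x $ 2 - c $ 2) > 0)"
    "x \<in> Q2 \<longleftrightarrow> x \<in> P \<and> (s2 * (x $ 2 - c $ 2) < 0 \<or> s3 * (x $ 3 - c $ 3) > 0)"
    "x \<in> Q3 \<longleftrightarrow> x \<in> P \<and> (s3 * (x $ 3 - c $ 3) < 0 \<or> s1 * (x $ 1 - c $ 1) < 0)" for x
    unfolding Q1_def Q2_def Q3_def d1(4) d2(4) d3(4) by simp_all
  have disj: "Q1 \<inter> Q2 = {}" "Q1 \<inter> Q3 = {}" "Q2 \<inter> Q3 = {}"
  proof -
    have "\<not> (x \<in> Q1 \<and> x \<in> Q2)" for x using plane(1,2)[of x] desc(1,2)[of x] by force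
    then show "Q1 \<inter> Q2 = {}" by blast
    have "\<not> (x \<in> Q1 \<and> x \<in> Q3)" for x using plane(1,3)[of x] desc(1,3)[of x] by force
    then show "Q1 \<inter> Q3 = {}" by blast
    have "\<not> (x \<in> Q2 \<and> x \<in> Q3)" for x using plane(2,3)[of x] desc(2,3)[of x] by force
    then show "Q2 \<inter> Q3 = {}" by blast
  qed
  have cover: "P - {c} = Q1 \<union> Q2 \<union> Q3"
  proof
    show "Q1 \<union> Q2 \<union> Q3 \<subseteq> P - {c}" using desc by auto
    show "P - {c} \<subseteq> Q1 \<union> Q2 \<union> Q3"
    proof
      fix x assume x: "x \<in> P - {c}"
      then obtain l where "x $ l \<noteq> c $ l" by (metis DiffD2 insertI1 vec_eq_iff)
      then have "x $ 1 \<noteq> c $ 1 \<or> x $ 2 \<noteq> c $ 2 \<or> x $ 3 \<noteq> c $ 3" using exhaust_3[of l] by metis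
      then have "s1 * (x $ 1 - c $ 1) \<noteq> 0 \<or> s2 * (x $ 2 - c $ 2) \<noteq> 0 \<or> s3 * (x $ 3 - c $ 3) \<noteq> 0"
        using s by auto
      then show "x \<in> Q1 \<union> Q2 \<union> Q3" using desc[of x] x by (metis DiffD1 UnCI linorder_neqE_linordered_idom)
    qed
  qed
  have dist: "distinct [d1, d2, d3]" using disj in_Q by auto
  have "{x \<in> P. adjacent c x} = {d1, d2, d3}"
  proof (intro equalityI subsetI)
    fix x assume "x \<in> {x \<in> P. adjacent c x}"
    then have x: "x \<in> P" "adjacent c x" by auto
    then have "x \<in> Q1 \<union> Q2 \<union> Q3" using cover adjacent_neq by blast
    then show "x \<in> {d1, d2, d3}"
      using unique_neighbour[OF c d1(1,2) x] unique_neighbour[OF c d2(1,2) x] unique_neighbour[OF c d3(1,2) x]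
      unfolding Q1_def Q2_def Q3_def by blast
  qed (use d1 d2 d3 in auto)
  moreover have "type_a c d1 d2 d3 \<or> type_b c d1 d2 d3"
    using three_neighbours_type d1 d2 d3 dist by blast
  moreover have "distinct [3, 1, 2 :: 3]" by simp
  moreover have "skew_arm c d1 3 Q1" "skew_arm c d2 1 Q2" "skew_arm c d3 2 Q3"
    unfolding Q1_def Q2_def Q3_def using d1 d2 d3 by auto
  ultimately show ?thesis
    unfolding skew_cross_def using min c dist cover disj
    by (intro conjI bexI[of _ c] exI[of _ d1] exI[of _ d2] exI[of _ d3] exI[of _ Q1] exI[of _ Q2]
        exI[of _ Q3] exI[of _ 3] exI[of _ 1] exI[of _ 2]) assumption+
qed

text \<open>\<open>Q\<close> and \<open>R\<close> are joined through \<open>c\<close> while avoiding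
  \<open>c'\<close>, and \<open>c'\<close> has the same coordinate along \<open>l\<close> as
  \<open>c\<close>, with \<open>x\<close> and \<open>y\<close> on different sides.\<close>

lemma two_sided_between:
  assumes c: "c \<in> P" and c': "c' \<in> P" "c' \<noteq> c" "c' $ l = c $ l" and d: "adjacent c d" "adjacent c e"
    and Q: "face_connected Q" "face_connected R" "d \<in> Q" "e \<in> R" "Q \<subseteq> P - {c'}" "R \<subseteq> P - {c'}"
    and xy: "x \<in> Q" "y \<in> R" "(x $ l - c $ l) * (y $ l - c $ l) < 0"
  shows "two_sided c'"
proof -
  have "face_connected (Q \<union> {c})"
    using face_connected_Un[OF Q(1) face_connected_singleton, of d c] Q(3) d adjacent_sym by blast
  then have "face_connected (Q \<union> {c} \<union> R)"
    using face_connected_Un[OF _ Q(2), of "Q \<union> {c}" c e] Q(4) d by blast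
  from face_connectedD[OF this, of "P - {c'}" x y] have "y \<in> component (P - {c'}) x"
    using Q c c' xy by blast
  then have "linked c' l (x $ l - c $ l) l (- (x $ l - c $ l))"
    unfolding linked_def using xy Q c' by (intro bexI[of _ x] bexI[of _ y])
      (auto simp: zero_less_mult_iff mult_less_0_iff)
  then show ?thesis by (rule two_sidedI)
qed

text \<open>Two arms leave \<open>c\<close> in opposite directions of the axis common to their
  planes. Coherent signs would put each arm on one of two sides, different for any two arms, which
  is impossible for three. From a cell of one arm, the other two, joined at \<open>c\<close>, lie on
  both sides of its plane.\<close>

lemma skew_cross_cells:
  assumes "skew_cross a b P"
  obtains c where "c \<in> P" "\<not> two_sided c" "\<And>\<sigma>. (\<And>i. \<sigma> i \<noteq> 0) \<Longrightarrow> \<not> coherent c \<sigma>"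
    "\<And>c'. c' \<in> P \<Longrightarrow> c' \<noteq> c \<Longrightarrow> two_sided c'"
proof -
  obtain c d1 d2 d3 Q1 Q2 Q3 n1 n2 n3 where c: "c \<in> P" and dist: "distinct [d1, d2, d3]"
    and nb: "{x \<in> P. adjacent c x} = {d1, d2, d3}" and n: "distinct [n1, n2, n3]"
    and arms: "skew_arm c d1 n1 Q1" "skew_arm c d2 n2 Q2" "skew_arm c d3 n3 Q3"
    and cover: "P - {c} = Q1 \<union> Q2 \<union> Q3"
    and disj: "Q1 \<inter> Q2 = {}" "Q1 \<inter> Q3 = {}" "Q2 \<inter> Q3 = {}"
    using assms unfolding skew_cross_def
    by (elim conjE bexE exE) (rule that, assumption+)
  have d: "d1 \<in> P" "adjacent c d1" "d2 \<in> P" "adjacent c d2" "d3 \<in> P" "adjacent c d3" using nb by blast+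
  note A1 = skew_armD[OF arms(1) d(2)] and A2 = skew_armD[OF arms(2) d(4)]
    and A3 = skew_armD[OF arms(3) d(6)]
  have sub: "Q1 \<subseteq> component (P - {c}) d1" "Q2 \<subseteq> component (P - {c}) d2" "Q3 \<subseteq> component (P - {c}) d3"
    using face_connectedD[OF A1(1) _ A1(2), of "P - {c}"] face_connectedD[OF A2(1) _ A2(2), of "P - {c}"]
      face_connectedD[OF A3(1) _ A3(2), of "P - {c}"] cover by blast+
  have sep: "component (P - {c}) e \<inter> component (P - {c}) f = {}"
    if "e \<in> P" "adjacent c e" "f \<in> P" "adjacent c f" "e \<noteq> f" for e f
    using unique_neighbour[OF c that(1,2,3,4)] that(5) component_sym component_trans by (metis disjoint_iff)
  have compP: "component (P - {c}) e \<subseteq> P - {c}" if "e \<in> P" "adjacent c e" for e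
    using component_sub[of e c] that adjacent_neq by blast
  \<comment> \<open>The arms cover \<open>P - {c}\<close> and lie in disjoint components, so they
    fill them.\<close>
  have Q: "component (P - {c}) d1 = Q1" "component (P - {c}) d2 = Q2" "component (P - {c}) d3 = Q3"
  proof -
    have dj: "component (P - {c}) d1 \<inter> component (P - {c}) d2 = {}"
      "component (P - {c}) d1 \<inter> component (P - {c}) d3 = {}"
      "component (P - {c}) d2 \<inter> component (P - {c}) d3 = {}"
      using sep[OF d(1,2) d(3,4)] sep[OF d(1,2) d(5,6)] sep[OF d(3,4) d(5,6)] dist by auto
    show "component (P - {c}) d1 = Q1" using sub compP[OF d(1,2)] dj unfolding cover by blast
    show "component (P - {c}) d2 = Q2" using sub compP[OF d(3,4)] dj unfolding cover by blast
    show "component (P - {c}) d3 = Q3" using sub compP[OF d(5,6)] dj unfolding cover by blast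
  qed
  have same: "\<exists>X\<in>{Q1, Q2, Q3}. x \<in> X \<and> y \<in> X" if "x \<in> P" "x \<noteq> c" "y \<in> component (P - {c}) x" for x y
  proof -
    have "x \<in> Q1 \<union> Q2 \<union> Q3" using that cover by blast
    then show ?thesis using that(3) component_trans[of x "P - {c}" _ y] unfolding Q[symmetric] by blast
  qed
  have two: "\<not> two_sided c"
  proof
    assume "two_sided c"
    then obtain i x y where xy: "x \<in> P" "y \<in> component (P - {c}) x" "x $ i > c $ i" "y $ i < c $ i"
      unfolding two_sided_def linked_def by auto
    then have "x \<noteq> c" by auto
    then have "(x $ i - c $ i) * (y $ i - c $ i) \<ge> 0" using same[OF xy(1) _ xy(2)] A1(4) A2(4) A3(4) by blast
    then show False using xy by (simp add: zero_le_mult_iff)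
  qed
  have opp: "\<exists>x\<in>component (P - {c}) e. \<exists>y\<in>component (P - {c}) f. (x $ l - c $ l) * (y $ l - c $ l) < 0"
    if e: "e \<in> P" "adjacent c e" "f \<in> P" "adjacent c f" "e \<noteq> f"
      and ex: "\<exists>x\<in>component (P - {c}) e. x $ l \<noteq> c $ l" "\<exists>x\<in>component (P - {c}) f. x $ l \<noteq> c $ l" for e f l
  proof -
    obtain x y where xy: "x \<in> component (P - {c}) e" "x $ l \<noteq> c $ l" "y \<in> component (P - {c}) f" "y $ l \<noteq> c $ l"
      using ex by blast
    have xyP: "x \<in> P" "y \<in> P" using xy compP e by blast+
    have "\<not> (x $ l - c $ l) * (y $ l - c $ l) > 0"
    proof
      assume "(x $ l - c $ l) * (y $ l - c $ l) > 0"
      moreover have "(x $ l - c $ l) * (x $ l - c $ l) > 0" using xy by (simp add: zero_less_mult_iff) linarith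
      ultimately have "y \<in> component (P - {c}) x" using separation[OF c xyP] by blast
      then show False using sep[OF e] xy component_trans by blast
    qed
    then have "(x $ l - c $ l) * (y $ l - c $ l) < 0" using xy by (metis linorder_neqE_linordered_idom mult_eq_0_iff right_minus_eq)
    then show ?thesis using xy by blast
  qed
  have o12: "\<exists>x\<in>Q1. \<exists>y\<in>Q2. (x $ n3 - c $ n3) * (y $ n3 - c $ n3) < 0"
    using opp[OF d(1,2) d(3,4), of n3] A1(5)[of n3] A2(5)[of n3] n dist unfolding Q by auto
  have o13: "\<exists>x\<in>Q1. \<exists>y\<in>Q3. (x $ n2 - c $ n2) * (y $ n2 - c $ n2) < 0"
    using opp[OF d(1,2) d(5,6), of n2] A1(5)[of n2] A3(5)[of n2] n dist unfolding Q by auto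
  have o23: "\<exists>x\<in>Q2. \<exists>y\<in>Q3. (x $ n1 - c $ n1) * (y $ n1 - c $ n1) < 0"
    using opp[OF d(3,4) d(5,6), of n1] A2(5)[of n1] A3(5)[of n1] n dist unfolding Q by auto
  have coh: "\<not> coherent c \<sigma>" if \<sigma>: "\<And>i. \<sigma> i \<noteq> 0" for \<sigma>
  proof
    assume coh: "coherent c \<sigma>"
    define pos where "pos X \<longleftrightarrow> (\<exists>x\<in>X. \<exists>i. \<sigma> i * (x $ i - c $ i) > 0)" for X
    define neg where "neg X \<longleftrightarrow> (\<exists>x\<in>X. \<exists>i. - \<sigma> i * (x $ i - c $ i) > 0)" for X
    have "\<not> (pos (component (P - {c}) e) \<and> neg (component (P - {c}) e))" if "e \<in> P" "adjacent c e" for e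
    proof
      assume "pos (component (P - {c}) e) \<and> neg (component (P - {c}) e)"
      then obtain x y i j where xy: "x \<in> component (P - {c}) e" "\<sigma> i * (x $ i - c $ i) > 0"
        "y \<in> component (P - {c}) e" "- \<sigma> j * (y $ j - c $ j) > 0" unfolding pos_def neg_def by blast
      then have "y \<in> component (P - {c}) x" "x \<in> P" using component_eq compP[OF that] by blast+
      then show False using coh xy unfolding coherent_def linked_def by blast
    qed
    then have "\<not> (pos Q1 \<and> neg Q1)" "\<not> (pos Q2 \<and> neg Q2)" "\<not> (pos Q3 \<and> neg Q3)"
      using d unfolding Q[symmetric] by blast+
    moreover have "pos X \<and> neg Y \<or> neg X \<and> pos Y"
      if ex: "\<exists>x\<in>X. \<exists>y\<in>Y. (x $ l - c $ l) * (y $ l - c $ l) < 0" for X Y l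
    proof -
      obtain x y where "x \<in> X" "y \<in> Y" "(x $ l - c $ l) * (y $ l - c $ l) < 0" using ex by blast
      moreover from this have "\<sigma> l * (x $ l - c $ l) > 0 \<and> - \<sigma> l * (y $ l - c $ l) > 0 \<or>
        - \<sigma> l * (x $ l - c $ l) > 0 \<and> \<sigma> l * (y $ l - c $ l) > 0"
        using \<sigma>[of l] by (auto simp: zero_less_mult_iff mult_less_0_iff)
      ultimately show ?thesis unfolding pos_def neg_def by blast
    qed
    ultimately show False using o12 o13 o23 by meson
  qed
  have "two_sided c'" if c': "c' \<in> P" "c' \<noteq> c" for c'
  proof -
    have sP: "Q1 \<subseteq> P" "Q2 \<subseteq> P" "Q3 \<subseteq> P" using cover by auto
    have "c' \<in> Q1 \<union> Q2 \<union> Q3" using cover c' by blast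
    then consider "c' \<in> Q1" | "c' \<in> Q2" | "c' \<in> Q3" by blast
    then show ?thesis
    proof cases
      case 1
      obtain x y where "x \<in> Q2" "y \<in> Q3" "(x $ n1 - c $ n1) * (y $ n1 - c $ n1) < 0" using o23 by blast
      moreover have "Q2 \<subseteq> P - {c'}" "Q3 \<subseteq> P - {c'}" using sP disj 1 by auto
      ultimately show ?thesis
        using two_sided_between[OF c c' A1(3)[OF 1] d(4,6) A2(1) A3(1) A2(2) A3(2)] by blast
    next
      case 2
      obtain x y where "x \<in> Q1" "y \<in> Q3" "(x $ n2 - c $ n2) * (y $ n2 - c $ n2) < 0" using o13 by blast
      moreover have "Q1 \<subseteq> P - {c'}" "Q3 \<subseteq> P - {c'}" using sP disj 2 by auto
      ultimately show ?thesis
        using two_sided_between[OF c c' A2(3)[OF 2] d(2,6) A1(1) A3(1) A1(2) A3(2)] by blast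
    next
      case 3
      obtain x y where "x \<in> Q1" "y \<in> Q2" "(x $ n3 - c $ n3) * (y $ n3 - c $ n3) < 0" using o12 by blast
      moreover have "Q1 \<subseteq> P - {c'}" "Q2 \<subseteq> P - {c'}" using sP disj 3 by auto
      ultimately show ?thesis
        using two_sided_between[OF c c' A3(3)[OF 3] d(2,4) A1(1) A2(1) A1(2) A2(2)] by blast
    qed
  qed
  then show ?thesis using that c two coh by blast
qed

end

text \<open>Signs oriented along the diagonal remove the case distinction on the order of the
  corners.\<close>

lemma Box_orthant:
  fixes \<sigma> :: "3 \<Rightarrow> int"
  assumes "\<And>i. \<sigma> i = 1 \<or> \<sigma> i = -1" "\<And>i. \<sigma> i * (q $ i - p $ i) \<ge> 0"
  shows "x \<in> Box p q \<longleftrightarrow> (\<forall>i. \<sigma> i * (x $ i - p $ i) \<ge> 0 \<and> \<sigma> i * (q $ i - x $ i) \<ge> 0)"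
proof -
  have "min (p $ i) (q $ i) \<le> x $ i \<and> x $ i \<le> max (p $ i) (q $ i) \<longleftrightarrow>
      \<sigma> i * (x $ i - p $ i) \<ge> 0 \<and> \<sigma> i * (q $ i - x $ i) \<ge> 0" for i
    using assms(1)[of i] assms(2)[of i] by (elim disjE) auto
  then show ?thesis unfolding Box_def by blast
qed

lemma Box_sym: "Box p q = Box q p"
  unfolding Box_def by (simp add: min.commute max.commute)

subsection \<open>Diagonal polyominoes\<close>

context minimal_polyomino
begin

text \<open>Cells are peeled off at the corner while it has exactly one neighbour; they form the
  stair. The process ends at a cell without neighbours, leaving no piece, or with two or three,
  where the rest is the piece. An orthant contains only three neighbours of its corner.\<close>

lemma stair_decomposition:
  fixes \<sigma> :: "3 \<Rightarrow> int"
  assumes \<sigma>: "\<And>i. \<sigma> i = 1 \<or> \<sigma> i = -1"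
    and C: "C \<subseteq> P" "face_connected C" "c \<in> C" "\<And>x i. x \<in> C \<Longrightarrow> \<sigma> i * (x $ i - c $ i) \<ge> 0"
  shows "\<exists>c' S T. C = S \<union> T \<and> stair c c' S \<and>
    (T = {} \<or> c' \<in> T \<and> face_connected T \<and> card {x \<in> T. adjacent c' x} \<in> {2, 3} \<and> T \<inter> S = {c'} \<and>
      (\<forall>x\<in>T. \<forall>i. \<sigma> i * (x $ i - c' $ i) \<ge> 0))"
  using C
proof (induction "card C" arbitrary: C c rule: less_induct)
  case less
  have fin: "finite C" using less.prems(1) finite finite_subset by blast
  define N where "N = {x \<in> C. adjacent c x}"
  have finN: "finite N" unfolding N_def using fin by simp
  have stair_c: "stair c c {c}"
    unfolding stair_def using less.prems(1,3) face_connected_singleton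
    by (auto intro!: minimal_inscribedI simp: inscribed_def Box_def)
  have nb: "\<exists>i. d = c + axis i (\<sigma> i)" if "d \<in> N" for d
  proof -
    have "adjacent c d" using that unfolding N_def by blast
    then obtain i s where i: "s = 1 \<or> s = -1" "d $ i = c $ i + s" "\<And>j. j \<noteq> i \<Longrightarrow> d $ j = c $ j"
      using adjacentE[of c d] by metis
    have "s = \<sigma> i" using less.prems(4)[of d i] that i(1,2) \<sigma>[of i] unfolding N_def by auto
    then have "d $ j = (c + axis i (\<sigma> i)) $ j" for j using i by (auto simp: axis_def)
    then show ?thesis by (auto simp: vec_eq_iff)
  qed
  have exit: "\<exists>e\<in>N. x \<in> component (C - {c}) e" if "x \<in> C" "x \<noteq> c" for x
  proof -
    have "x \<in> component C c" using face_connectedD[OF less.prems(2)] that less.prems(3) by blast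
    then show ?thesis using component_exit[of x C c] that(2) unfolding N_def by blast
  qed
  consider "card N = 0" | "card N = 1" | "card N \<ge> 2" by linarith
  then consider "N = {}" | d where "N = {d}" | "card N \<ge> 2"
    using finN by cases (auto simp: card_1_singleton_iff)
  then show ?case
  proof cases
    case 1
    then have "C = {c} \<union> {}" using exit less.prems(3) by blast
    then show ?thesis using stair_c by blast
  next
    case 3
    have "N \<subseteq> (\<lambda>i. c + axis i (\<sigma> i)) ` UNIV" using nb by blast
    then have "card N \<le> card ((\<lambda>i. c + axis i (\<sigma> i)) ` UNIV)" by (intro card_mono) auto
    also have "\<dots> \<le> CARD(3)" by (intro card_image_le) auto
    finally have "card N \<le> 3" by simp
    then have "card {x \<in> C. adjacent c x} \<in> {2, 3}" using 3 unfolding N_def by auto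
    moreover have "C = {c} \<union> C" "C \<inter> {c} = {c}" using less.prems(3) by auto
    ultimately show ?thesis using stair_c less.prems
      by (intro exI[of _ c] exI[of _ "{c}"] exI[of _ C]) auto
  next
    case (2 d)
    then have d: "d \<in> C" "adjacent c d" unfolding N_def by auto
    define D where "D = C - {c}"
    have dD: "d \<in> D" unfolding D_def using d adjacent_neq by blast
    have con: "face_connected D"
      unfolding D_def by (rule face_connectedI[of _ d]) (use exit 2 in blast)
    have cP: "c \<in> P" "d \<in> P" using less.prems d by auto
    have "D \<subseteq> P - {c}" unfolding D_def using less.prems(1) by blast
    then have in_comp: "x \<in> component (P - {c}) d" if "x \<in> D" for x
      using face_connectedD[OF con _ dD that] by blast
    \<comment> \<open>The only neighbour \<open>d\<close> inherits the role of corner: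
      \<open>edge_side\<close> gives the inequality along the axis of the step, and along the others
      \<open>d\<close> agrees with \<open>c\<close>.\<close>
    have orth: "\<sigma> i * (x $ i - d $ i) \<ge> 0" if "x \<in> D" for x i
    proof -
      obtain k where k: "d = c + axis k (\<sigma> k)" using nb 2 by blast
      show ?thesis
      proof (cases "i = k")
        case True
        then have "d $ i - c $ i = \<sigma> i" using k by (simp add: axis_def)
        then show ?thesis using edge_side[OF cP d(2) in_comp[OF that], of i] by (simp add: mult.commute)
      next
        case False
        then have "d $ i = c $ i" using k by (simp add: axis_def)
        then show ?thesis using less.prems(4)[of x i] that unfolding D_def by simp
      qed
    qed
    have "card D < card C" unfolding D_def using less.prems(3) fin by (metis card_Diff1_less)
    moreover have "D \<subseteq> P" unfolding D_def using less.prems(1) by blast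
    ultimately obtain c' S T where IH: "D = S \<union> T" "stair d c' S"
      "T = {} \<or> c' \<in> T \<and> face_connected T \<and> card {x \<in> T. adjacent c' x} \<in> {2, 3} \<and> T \<inter> S = {c'} \<and>
      (\<forall>x\<in>T. \<forall>i. \<sigma> i * (x $ i - c' $ i) \<ge> 0)"
      using less.hyps[of D d] con dD orth by blast
    have S: "face_connected S" "d \<in> S" "c' \<in> S" "S \<subseteq> Box d c'"
      using IH(2) unfolding stair_def minimal_inscribed_def polyomino_def inscribed_def by auto
    have c'C: "c' \<in> D" using S IH(1) by blast
    have "face_connected (insert c S)"
      using face_connected_insert[OF S(1,2)] d(2) adjacent_sym by blast
    moreover have "insert c S \<subseteq> P" using IH(1) \<open>D \<subseteq> P\<close> cP by blast
    moreover have "insert c S \<subseteq> Box c c'"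
    proof
      fix x assume x: "x \<in> insert c S"
      have c'c: "\<sigma> i * (c' $ i - c $ i) \<ge> 0" for i using less.prems(4) c'C unfolding D_def by blast
      show "x \<in> Box c c'"
      proof (cases "x = c")
        case True then show ?thesis by (auto simp: Box_def)
      next
        case False
        then have "x \<in> Box d c'" "x \<in> D" using x S(4) IH(1) by auto
        then have "\<sigma> i * (c' $ i - x $ i) \<ge> 0" for i
          using Box_orthant[where \<sigma> = \<sigma> and p = d and q = c' and x = x] \<sigma> orth[OF c'C] by blast
        moreover have "\<sigma> i * (x $ i - c $ i) \<ge> 0" for i using less.prems(4) \<open>x \<in> D\<close> unfolding D_def by blast
        ultimately show ?thesis
          using Box_orthant[where \<sigma> = \<sigma> and p = c and q = c' and x = x] \<sigma> c'c by blast
      qed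
    qed
    moreover from this have "inscribed c c' (insert c S)" using S(3) unfolding inscribed_def by blast
    ultimately have "stair c c' (insert c S)"
      unfolding stair_def using S(3) minimal_inscribedI[of "insert c S"] by simp
    moreover have "C = insert c S \<union> T" using IH(1) less.prems(3) unfolding D_def by blast
    moreover have "T \<inter> insert c S = T \<inter> S" using IH(1) unfolding D_def by blast
    ultimately show ?thesis
      using IH(3) by (intro exI[of _ c'] exI[of _ "insert c S"] exI[of _ T] conjI) (assumption, assumption, simp)
  qed
qed

text \<open>The component of any cell of the orthant other than \<open>c\<close> stays in the
  orthant and becomes a connected set through \<open>c\<close> when \<open>c\<close> is
  added.\<close>

lemma coherent_orthant_connected:
  assumes c: "c \<in> P" and coh: "coherent c \<sigma>" and \<sigma>: "\<And>i. \<sigma> i = 1 \<or> \<sigma> i = -1"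
  shows "face_connected {x \<in> P. \<forall>i. \<sigma> i * (x $ i - c $ i) \<ge> 0}" (is "face_connected ?O")
proof (rule face_connectedI[of _ c])
  fix x assume x: "x \<in> ?O"
  show "x \<in> component ?O c"
  proof (cases "x = c")
    case True then show ?thesis by (simp add: component_self)
  next
    case False
    then obtain i where "x $ i \<noteq> c $ i" by (metis vec_eq_iff)
    then have pos: "\<sigma> i * (x $ i - c $ i) > 0" using x \<sigma>[of i] by (auto simp: order_le_less)
    have "component (P - {c}) x \<subseteq> ?O"
    proof
      fix y assume y: "y \<in> component (P - {c}) x"
      then have "y \<in> P" using component_sub[of x c] x False by blast
      moreover have "\<sigma> j * (y $ j - c $ j) \<ge> 0" for j
      proof (rule ccontr)
        assume "\<not> ?thesis"
        then have "- \<sigma> j * (y $ j - c $ j) > 0" by simp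
        then show False using coh pos x y unfolding coherent_def linked_def by blast
      qed
      ultimately show "y \<in> ?O" by blast
    qed
    then have "insert c (component (P - {c}) x) \<subseteq> ?O" using c by auto
    moreover have "face_connected (insert c (component (P - {c}) x))"
      using component_insert_connected[OF c _ False] x by blast
    ultimately show ?thesis using face_connectedD[of "insert c (component (P - {c}) x)" ?O c x]
        component_self by blast
  qed
qed

text \<open>Cells outside \<open>T\<close> do not pass \<open>c'\<close> towards \<open>B\<close>,
  so each face through \<open>B\<close> is met by \<open>T\<close> or contains
  \<open>c'\<close>.\<close>

lemma end_piece_inscribed:
  assumes T: "T \<subseteq> P" "face_connected T" "c' \<in> T" "\<And>x i. x \<in> T \<Longrightarrow> \<sigma> i * (x $ i - c' $ i) \<ge> 0"
    and \<sigma>: "\<And>i. \<sigma> i = 1 \<or> \<sigma> i = -1"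
    and B: "\<And>x i. x \<in> P \<Longrightarrow> \<sigma> i * (B $ i - x $ i) \<ge> 0" "\<And>i. \<exists>x\<in>P. x $ i = B $ i"
    and rest: "\<And>x i. x \<in> P \<Longrightarrow> x \<notin> T \<Longrightarrow> \<sigma> i * (c' $ i - x $ i) \<ge> 0"
  shows "minimal_inscribed B c' T"
proof (rule minimal_inscribedI)
  have "\<sigma> i * (B $ i - c' $ i) \<ge> 0" for i using B(1) T(1,3) by blast
  note box = Box_orthant[of \<sigma> B c', OF \<sigma> this]
  have "T \<subseteq> Box c' B"
  proof
    fix x assume "x \<in> T"
    then show "x \<in> Box c' B" unfolding box using T(1,4) B(1) by blast
  qed
  moreover have "\<exists>x\<in>T. x $ i = B $ i" for i
  proof -
    obtain x where x: "x \<in> P" "x $ i = B $ i" using B(2) by blast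
    show ?thesis
    proof (cases "x \<in> T")
      case True then show ?thesis using x by blast
    next
      case False
      have "c' $ i = B $ i" using rest[OF x(1) False, of i] B(1)[of c' i] T(1,3) x(2) \<sigma>[of i] by auto
      then show ?thesis using T(3) by blast
    qed
  qed
  ultimately show "inscribed B c' T" unfolding inscribed_def using T(3) Box_sym by blast
qed (use T in auto)

text \<open>The two opposite orthants cover \<open>P\<close> and meet only in \<open>c\<close>. Each
  splits into a stair from \<open>c\<close> and an end piece, and the two stairs join at
  \<open>c\<close> to a single stair running along the same diagonal.\<close>

lemma coherent_diagonal:
  assumes min: "minimal_inscribed a b P" and c: "c \<in> P" and coh: "coherent c \<sigma>"
    and \<sigma>: "\<And>i. \<sigma> i = 1 \<or> \<sigma> i = -1"
  shows "diagonal a b P"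
proof -
  define O1 where "O1 = {x \<in> P. \<forall>i. - \<sigma> i * (x $ i - c $ i) \<ge> 0}"
  define O2 where "O2 = {x \<in> P. \<forall>i. \<sigma> i * (x $ i - c $ i) \<ge> 0}"
  have \<sigma>': "- \<sigma> i = 1 \<or> - \<sigma> i = -1" for i using \<sigma>[of i] by auto
  have coh': "coherent c (\<lambda>i. - \<sigma> i)"
    using coh linked_sym unfolding coherent_def by fastforce
  have con: "face_connected O1" "face_connected O2"
    unfolding O1_def O2_def
    using coherent_orthant_connected[OF c coh' \<sigma>'] coherent_orthant_connected[OF c coh \<sigma>] by auto
  have cO: "c \<in> O1" "c \<in> O2" unfolding O1_def O2_def using c by auto
  have cover: "P = O1 \<union> O2"
  proof
    show "P \<subseteq> O1 \<union> O2"
    proof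
      fix x assume x: "x \<in> P"
      show "x \<in> O1 \<union> O2"
      proof (rule ccontr)
        assume "x \<notin> O1 \<union> O2"
        then obtain i j where "\<not> - \<sigma> i * (x $ i - c $ i) \<ge> 0" "\<not> \<sigma> j * (x $ j - c $ j) \<ge> 0"
          unfolding O1_def O2_def using x by blast
        then have "\<sigma> i * (x $ i - c $ i) > 0" "- \<sigma> j * (x $ j - c $ j) > 0" by simp_all
        then show False using coh x component_self unfolding coherent_def linked_def by blast
      qed
    qed
  qed (auto simp: O1_def O2_def)
  obtain c1 S1 T1 where 1: "O1 = S1 \<union> T1" "stair c c1 S1"
    "T1 = {} \<or> c1 \<in> T1 \<and> face_connected T1 \<and> card {x \<in> T1. adjacent c1 x} \<in> {2, 3} \<and> T1 \<inter> S1 = {c1} \<and>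
      (\<forall>x\<in>T1. \<forall>i. - \<sigma> i * (x $ i - c1 $ i) \<ge> 0)"
    using stair_decomposition[of "\<lambda>i. - \<sigma> i" O1 c, OF \<sigma>' _ con(1) cO(1)] unfolding O1_def by blast
  obtain c2 S2 T2 where 2: "O2 = S2 \<union> T2" "stair c c2 S2"
    "T2 = {} \<or> c2 \<in> T2 \<and> face_connected T2 \<and> card {x \<in> T2. adjacent c2 x} \<in> {2, 3} \<and> T2 \<inter> S2 = {c2} \<and>
      (\<forall>x\<in>T2. \<forall>i. \<sigma> i * (x $ i - c2 $ i) \<ge> 0)"
    using stair_decomposition[of \<sigma> O2 c, OF \<sigma> _ con(2) cO(2)] unfolding O2_def by blast
  have S1: "face_connected S1" "c \<in> S1" "c1 \<in> S1" "S1 \<subseteq> Box c c1"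
    using 1(2) unfolding stair_def minimal_inscribed_def polyomino_def inscribed_def by auto
  have S2: "face_connected S2" "c \<in> S2" "c2 \<in> S2" "S2 \<subseteq> Box c c2"
    using 2(2) unfolding stair_def minimal_inscribed_def polyomino_def inscribed_def by auto
  have o1: "\<sigma> i * (c $ i - x $ i) \<ge> 0" if "x \<in> O1" for x i
    using that \<sigma>[of i] unfolding O1_def by (elim disjE) (auto dest: spec[of _ i])
  have o2: "\<sigma> i * (x $ i - c $ i) \<ge> 0" if "x \<in> O2" for x i
    using that unfolding O2_def by blast
  have c1O: "c1 \<in> O1" and c2O: "c2 \<in> O2" using S1 S2 1(1) 2(1) by auto
  have s1: "\<sigma> i * (x $ i - c1 $ i) \<ge> 0" if "x \<in> S1" for x i
    using Box_orthant[of \<sigma> c c1 x, OF \<sigma>] o1[OF c1O] S1(4) that Box_sym by blast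
  have s2: "\<sigma> i * (c2 $ i - x $ i) \<ge> 0" if "x \<in> S2" for x i
    using Box_orthant[of \<sigma> c2 c x, OF \<sigma>] o2[OF c2O] S2(4) that by blast
  have tri: "\<sigma> i * (z $ i - x $ i) \<ge> 0" if "\<sigma> i * (y $ i - x $ i) \<ge> 0" "\<sigma> i * (z $ i - y $ i) \<ge> 0" for x y z :: cell and i
    using that \<sigma>[of i] by auto
  have c12: "\<sigma> i * (c2 $ i - c1 $ i) \<ge> 0" for i using tri[OF o1[OF c1O] o2[OF c2O]] .
  define S where "S = S1 \<union> S2"
  have SP: "S \<subseteq> P" unfolding S_def using 1(1) 2(1) cover by blast
  have sS: "\<sigma> i * (x $ i - c1 $ i) \<ge> 0 \<and> \<sigma> i * (c2 $ i - x $ i) \<ge> 0" if "x \<in> S" for x i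
    using that unfolding S_def
  proof
    assume x: "x \<in> S1"
    then have "x \<in> O1" using 1(1) by blast
    then show ?thesis using s1[OF x] tri[OF o1 o2[OF c2O]] by blast
  next
    assume x: "x \<in> S2"
    then have "x \<in> O2" using 2(1) by blast
    then show ?thesis using s2[OF x] tri[OF o1[OF c1O] o2] by blast
  qed
  have "S \<subseteq> Box c1 c2" using sS Box_orthant[of \<sigma> c2 c1, OF \<sigma> c12] by blast
  moreover have "face_connected S" unfolding S_def using face_connected_Un S1 S2 by blast
  moreover from calculation have "inscribed c1 c2 S"
    unfolding inscribed_def S_def using S1(3) S2(3) by blast
  ultimately have stair: "stair c1 c2 S"
    unfolding stair_def using S1(3) S2(3) SP minimal_inscribedI[of S c1 c2] by (auto simp: S_def)
  have ins: "P \<subseteq> Box a b" "\<exists>x\<in>P. x $ i = a $ i" "\<exists>x\<in>P. x $ i = b $ i" for i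
    using min unfolding minimal_inscribed_def inscribed_def by auto
  \<comment> \<open>Along every axis the corners are ordered so that \<open>\<sigma> i\<close>
    points from \<open>A\<close> to \<open>B\<close>.\<close>
  define A :: cell where "A = (\<chi> i. if \<sigma> i = 1 then min (a $ i) (b $ i) else max (a $ i) (b $ i))"
  define B :: cell where "B = (\<chi> i. if \<sigma> i = 1 then max (a $ i) (b $ i) else min (a $ i) (b $ i))"
  have "{A $ i, B $ i} = {a $ i, b $ i}" for i unfolding A_def B_def by (auto simp: min_def max_def)
  then have opp: "opposite_corners a b A B" unfolding opposite_corners_def by blast
  have faces: "\<exists>x\<in>P. x $ i = A $ i" "\<exists>x\<in>P. x $ i = B $ i" for i
    using ins(2,3)[of i] unfolding A_def B_def by (auto simp: min_def max_def)
  have AB: "\<sigma> i * (x $ i - A $ i) \<ge> 0" "\<sigma> i * (B $ i - x $ i) \<ge> 0" if "x \<in> P" for x i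
  proof -
    have "min (a $ i) (b $ i) \<le> x $ i" "x $ i \<le> max (a $ i) (b $ i)"
      using that ins(1) unfolding Box_def by auto
    then show "\<sigma> i * (x $ i - A $ i) \<ge> 0" "\<sigma> i * (B $ i - x $ i) \<ge> 0"
      using \<sigma>[of i] unfolding A_def B_def by auto
  qed
  have "\<sigma> i * (B $ i - A $ i) \<ge> 0" for i using tri[OF AB[OF c]] .
  then have "P \<subseteq> Box A B" using Box_orthant[of \<sigma> B A, OF \<sigma>] AB by blast
  then have minAB: "minimal_inscribed A B P"
    using minimal_inscribedI[OF subset_refl nonempty conn] faces unfolding inscribed_def by blast
  have cP: "c1 \<in> P" "c2 \<in> P" using c1O c2O cover by auto
  have box: "c1 \<in> Box A c2" "c2 \<in> Box c1 B"
    using Box_orthant[of \<sigma> c2 A, OF \<sigma>] Box_orthant[of \<sigma> B c1, OF \<sigma>] AB cP c12 by blast+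
  have inter: "x = c" if "x \<in> O1" "x \<in> O2" for x
  proof -
    have "x $ i = c $ i" for i using o1[OF that(1), of i] o2[OF that(2), of i] \<sigma>[of i] by auto
    then show ?thesis by (simp add: vec_eq_iff)
  qed
  have e1: "end_piece A c1 S T1"
  proof (cases "T1 = {}")
    case True then show ?thesis by (simp add: end_piece_def)
  next
    case False
    then have T: "c1 \<in> T1" "face_connected T1" "card {x \<in> T1. adjacent c1 x} \<in> {2, 3}" "T1 \<inter> S1 = {c1}"
      "\<And>x i. x \<in> T1 \<Longrightarrow> - \<sigma> i * (x $ i - c1 $ i) \<ge> 0" using 1(3) by auto
    have "T1 \<inter> S = {c1}" unfolding S_def using T(1,4) inter S1 1(1) 2(1) by blast
    moreover have "minimal_inscribed A c1 T1"
    proof (rule end_piece_inscribed[of T1 c1 "\<lambda>i. - \<sigma> i"])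
      show "T1 \<subseteq> P" using 1(1) cover by blast
      show "- \<sigma> i * (A $ i - x $ i) \<ge> 0" if "x \<in> P" for x i using AB(1)[OF that, of i] \<sigma>[of i] by auto
      show "- \<sigma> i * (c1 $ i - x $ i) \<ge> 0" if "x \<in> P" "x \<notin> T1" for x i
      proof -
        have "x \<in> S1 \<or> x \<in> O2" using that cover 1(1) by blast
        then have "\<sigma> i * (x $ i - c1 $ i) \<ge> 0" using s1 tri[OF o1[OF c1O] o2] by blast
        then show ?thesis using \<sigma>[of i] by auto
      qed
    qed (use T \<sigma>' faces in auto)
    ultimately show ?thesis unfolding end_piece_def using T by blast
  qed
  have e2: "end_piece B c2 S T2"
  proof (cases "T2 = {}")
    case True then show ?thesis by (simp add: end_piece_def)
  next
    case False
    then have T: "c2 \<in> T2" "face_connected T2" "card {x \<in> T2. adjacent c2 x} \<in> {2, 3}" "T2 \<inter> S2 = {c2}"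
      "\<And>x i. x \<in> T2 \<Longrightarrow> \<sigma> i * (x $ i - c2 $ i) \<ge> 0" using 2(3) by auto
    have "T2 \<inter> S = {c2}" unfolding S_def using T(1,4) inter S2 1(1) 2(1) by blast
    moreover have "minimal_inscribed B c2 T2"
    proof (rule end_piece_inscribed[of T2 c2 \<sigma>])
      show "T2 \<subseteq> P" using 2(1) cover by blast
      show "\<sigma> i * (c2 $ i - x $ i) \<ge> 0" if "x \<in> P" "x \<notin> T2" for x i
      proof -
        have "x \<in> S2 \<or> x \<in> O1" using that cover 2(1) by blast
        then show ?thesis using s2 tri[OF o1 o2[OF c2O]] by blast
      qed
    qed (use T \<sigma> faces AB in auto)
    ultimately show ?thesis unfolding end_piece_def using T by blast
  qed
  have "P = S \<union> T1 \<union> T2" unfolding S_def using cover 1(1) 2(1) by blast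
  then have "diagonal_along A B P"
    unfolding diagonal_along_def using minAB box stair e1 e2 by blast
  then show ?thesis unfolding diagonal_def using opp by blast
qed

text \<open>A walk avoiding \<open>c\<close> cannot change orthant: adjacent cells in opposite
  orthants agree with \<open>c\<close> off one axis, and on that axis lie strictly on different
  sides of \<open>c\<close>, at distance at least two.\<close>

lemma coherentI:
  assumes \<sigma>: "\<And>i. \<sigma> i = 1 \<or> \<sigma> i = -1"
    and orth: "\<And>x. x \<in> P \<Longrightarrow> (\<forall>i. \<sigma> i * (x $ i - c $ i) \<ge> 0) \<or> (\<forall>i. \<sigma> i * (x $ i - c $ i) \<le> 0)"
  shows "coherent c \<sigma>"
  unfolding coherent_def
proof (intro allI notI)
  fix i j assume "linked c i (\<sigma> i) j (- \<sigma> j)"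
  then obtain x y where xy: "x \<in> P" "y \<in> component (P - {c}) x" "\<sigma> i * (x $ i - c $ i) > 0" "- \<sigma> j * (y $ j - c $ j) > 0"
    unfolding linked_def by blast
  have "\<forall>i. \<sigma> i * (y $ i - c $ i) \<ge> 0"
    using xy(2)
  proof (induction rule: component_induct)
    case base
    show ?case using orth[OF xy(1)] xy(3) by (meson not_le)
  next
    case (step y z)
    show ?case
    proof (rule ccontr)
      assume "\<not> ?thesis"
      then have neg: "\<forall>i. \<sigma> i * (z $ i - c $ i) \<le> 0" using orth[of z] step.hyps by blast
      obtain k where k: "\<And>l. l \<noteq> k \<Longrightarrow> z $ l = y $ l" "z $ k = y $ k + 1 \<or> z $ k = y $ k - 1"
        using adjacentE[OF step.hyps(4)] by (metis diff_conv_add_uminus)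
      have off: "y $ l = c $ l" "z $ l = c $ l" if "l \<noteq> k" for l
        using step.IH[rule_format, of l] neg[rule_format, of l] k(1)[OF that] \<sigma>[of l] by auto
      then have "y $ k \<noteq> c $ k" "z $ k \<noteq> c $ k" using step.hyps by (metis DiffD2 insertI1 vec_eq_iff)+
      then show False
        using step.IH[rule_format, of k] neg[rule_format, of k] k(2) \<sigma>[of k] by auto
    qed
  qed
  then have "\<sigma> j * (y $ j - c $ j) \<ge> 0" by blast
  then show False using xy(4) by simp
qed

text \<open>The cell \<open>c1\<close> serves: the stair and the piece at \<open>c2\<close> lie in
  the orthant towards \<open>B\<close>, the piece at \<open>c1\<close> in the opposite one.\<close>

lemma diagonal_coherent:
  assumes "diagonal a b P"
  obtains c \<sigma> where "c \<in> P" "coherent c \<sigma>" "\<And>i. \<sigma> i = 1 \<or> \<sigma> i = -1"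
proof -
  obtain A B c1 c2 S T1 T2 where min: "minimal_inscribed A B P" and c12: "c1 \<in> Box A c2" "c2 \<in> Box c1 B"
    and pieces: "stair c1 c2 S" "end_piece A c1 S T1" "end_piece B c2 S T2" "P = S \<union> T1 \<union> T2"
    using assms unfolding diagonal_def diagonal_along_def by blast
  define \<sigma> :: "3 \<Rightarrow> int" where "\<sigma> i = (if A $ i \<le> B $ i then 1 else -1)" for i
  have c: "c1 \<in> P" "c2 \<in> P" using pieces unfolding stair_def by auto
  have between: "min (p $ i) (q $ i) \<le> x $ i" "x $ i \<le> max (p $ i) (q $ i)" if "x \<in> Box p q" for x p q i
    using that unfolding Box_def by auto
  have PAB: "P \<subseteq> Box A B" using min unfolding minimal_inscribed_def inscribed_def by blast
  have le: "\<sigma> i * (c2 $ i - c1 $ i) \<ge> 0" "\<sigma> i * (c1 $ i - A $ i) \<ge> 0" "\<sigma> i * (B $ i - c2 $ i) \<ge> 0" for i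
    using between[OF c12(1), of i] between[OF c12(2), of i] between[OF subsetD[OF PAB c(1)], of i]
      between[OF subsetD[OF PAB c(2)], of i] unfolding \<sigma>_def by (auto split: if_splits)
  have "(\<forall>i. \<sigma> i * (x $ i - c1 $ i) \<ge> 0) \<or> (\<forall>i. \<sigma> i * (x $ i - c1 $ i) \<le> 0)" if "x \<in> P" for x
  proof -
    have "S \<subseteq> Box c1 c2" "T1 \<subseteq> Box A c1" "T2 \<subseteq> Box B c2"
      using pieces(1-3) unfolding stair_def end_piece_def minimal_inscribed_def inscribed_def by auto
    then have "x \<in> Box c1 c2 \<or> x \<in> Box A c1 \<or> x \<in> Box B c2" using that pieces(4) by blast
    then consider "x \<in> Box c1 c2" | "x \<in> Box A c1" | "x \<in> Box B c2" by blast
    then show ?thesis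
    proof cases
      case 1
      have "\<sigma> i * (x $ i - c1 $ i) \<ge> 0" for i
        using between[OF 1, of i] le(1)[of i] unfolding \<sigma>_def by (auto split: if_splits)
      then show ?thesis by blast
    next
      case 2
      have "\<sigma> i * (x $ i - c1 $ i) \<le> 0" for i
        using between[OF 2, of i] le(2)[of i] unfolding \<sigma>_def by (auto split: if_splits)
      then show ?thesis by blast
    next
      case 3
      have "\<sigma> i * (x $ i - c1 $ i) \<ge> 0" for i
        using between[OF 3, of i] le(1,3)[of i] unfolding \<sigma>_def by (auto split: if_splits)
      then show ?thesis by blast
    qed
  qed
  moreover have "\<sigma> i = 1 \<or> \<sigma> i = -1" for i unfolding \<sigma>_def by auto
  ultimately show ?thesis using coherentI[of \<sigma> c1] that c by blast
qed

end

subsection \<open>2D x 2D polyominoes\<close>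

lemma on_line_sym: "on_line v e f \<longleftrightarrow> on_line v f e"
  unfolding on_line_def by auto

lemma Box_line:
  assumes "on_line v f g"
  shows "x \<in> Box f g \<longleftrightarrow> on_line v f x \<and> (x $ v - f $ v) * (x $ v - g $ v) \<le> 0"
proof -
  have "min (f $ i) (g $ i) \<le> x $ i \<and> x $ i \<le> max (f $ i) (g $ i) \<longleftrightarrow>
    (if i = v then (x $ v - f $ v) * (x $ v - g $ v) \<le> 0 else f $ i = x $ i)" for i
  proof (cases "i = v")
    case True
    then show ?thesis by (auto simp: mult_le_0_iff)
  next
    case False
    then have "g $ i = f $ i" using assms unfolding on_line_def by auto
    then show ?thesis using False by auto
  qed
  then show ?thesis unfolding Box_def on_line_def by auto
qed

lemma adjacent_on_line:
  assumes "adjacent c d"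
  obtains v where "on_line v c d" "\<bar>d $ v - c $ v\<bar> = 1"
proof -
  obtain i where i: "\<bar>c $ i - d $ i\<bar> = 1" "\<forall>j. j \<noteq> i \<longrightarrow> c $ j = d $ j"
    using assms unfolding adjacent_def by blast
  then show ?thesis using that[of i] unfolding on_line_def by auto
qed

lemma on_line_adjacent: "on_line v c d \<Longrightarrow> \<bar>d $ v - c $ v\<bar> = 1 \<Longrightarrow> adjacent c d"
  unfolding adjacent_def on_line_def by (intro exI[of _ v]) auto

section \<open>Double edges\<close>

context minimal_polyomino
begin

text \<open>A negative product means that \<open>p\<close> and \<open>q\<close> lie on different
  sides. In a 2D x 2D polyomino such an edge is found on the straight segment, with \<open>u\<close>
  the axis of the pilar beyond \<open>d\<close> and \<open>w\<close> that of the pilar beyond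
  \<open>c\<close>.\<close>

definition double_edge :: "cell \<Rightarrow> cell \<Rightarrow> 3 \<Rightarrow> 3 \<Rightarrow> bool" where
  "double_edge c d u w \<longleftrightarrow> c \<in> P \<and> d \<in> P \<and> adjacent c d \<and>
     (\<exists>p\<in>component (P - {c}) d. \<exists>q\<in>component (P - {c}) d. (p $ u - c $ u) * (q $ u - c $ u) < 0) \<and>
     (\<exists>p\<in>component (P - {d}) c. \<exists>q\<in>component (P - {d}) c. (p $ w - d $ w) * (q $ w - d $ w) < 0)"

lemma double_edge_sym: "double_edge c d u w \<longleftrightarrow> double_edge d c w u"
  unfolding double_edge_def using adjacent_sym by blast

lemma two_sided_if_opposite:
  assumes "p \<in> P" "q \<in> component (P - {c}) p" "(p $ l - c $ l) * (q $ l - c $ l) < 0"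
  shows "two_sided c"
proof -
  have "linked c l (p $ l - c $ l) l (- (p $ l - c $ l))"
    unfolding linked_def using assms by (intro bexI[of _ p] bexI[of _ q])
      (auto simp: zero_less_mult_iff mult_less_0_iff)
  then show ?thesis by (rule two_sidedI)
qed

text \<open>Both directions along \<open>l\<close> already occur in the component of
  \<open>p\<close>, so separation draws every cell off the layer of \<open>c\<close> into
  it.\<close>

lemma separation_opposite:
  assumes "c \<in> P" "p \<in> P" "q \<in> component (P - {c}) p" "(p $ l - c $ l) * (q $ l - c $ l) < 0"
    and "x \<in> P" "x $ l \<noteq> c $ l"
  shows "x \<in> component (P - {c}) p"
proof -
  have "q \<in> P" using component_sub[of p c] assms by fastforce
  have "(p $ l - c $ l) * (x $ l - c $ l) > 0 \<or> (q $ l - c $ l) * (x $ l - c $ l) > 0"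
    using assms(4,6) unfolding zero_less_mult_iff mult_less_0_iff by linarith
  moreover have "(p $ l - c $ l) * (p $ l - c $ l) > 0" "(q $ l - c $ l) * (q $ l - c $ l) > 0"
    using assms(4) unfolding zero_less_mult_iff mult_less_0_iff by linarith+
  ultimately have "x \<in> component (P - {c}) p \<or> x \<in> component (P - {c}) q"
    using separation[OF assms(1,2,5)] separation[OF assms(1) \<open>q \<in> P\<close> assms(5)] by blast
  then show ?thesis using assms(3) component_trans by metis
qed

text \<open>All cells that differ from \<open>c\<close> along \<open>u\<close> belong to the side of
  \<open>d\<close>, which leaves the side of \<open>c\<close> flat. Seen from any cell
  \<open>z\<close> of this flat side, the side of \<open>d\<close> is connected, avoids
  \<open>z\<close> and lies on both sides of it.\<close>

lemma double_edge_half: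
  assumes "double_edge c d u w"
  shows "x \<in> component (P - {d}) c \<Longrightarrow> x $ u = c $ u"
    and "\<And>z. z \<in> component (P - {d}) c \<Longrightarrow> two_sided z"
proof -
  let ?K = "component (P - {c}) d" and ?K' = "component (P - {d}) c"
  obtain p q where c: "c \<in> P" and d: "d \<in> P" "adjacent c d" and pq: "p \<in> ?K" "q \<in> ?K" "(p $ u - c $ u) * (q $ u - c $ u) < 0"
    using assms unfolding double_edge_def by blast
  have dc: "d \<noteq> c" using d adjacent_neq by blast
  have sub: "?K \<subseteq> P - {c}" "?K' \<subseteq> P - {d}" using component_sub c d dc by auto
  have disj: "?K \<inter> ?K' = {}" by (rule edge_disjoint[OF c d])
  have pP: "p \<in> P" using pq sub by blast
  have eq: "component (P - {c}) p = ?K" by (rule component_eq[OF pq(1)])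
  show side: "x $ u = c $ u" if x: "x \<in> ?K'" for x
  proof (rule ccontr)
    assume "x $ u \<noteq> c $ u"
    moreover have "x \<in> P" using x sub by blast
    ultimately have "x \<in> ?K" using separation_opposite[OF c pP _ pq(3)] pq eq by blast
    then show False using disj x by blast
  qed
  show "two_sided z" if z: "z \<in> ?K'" for z
  proof (rule two_sided_if_opposite[OF pP])
    have "z \<notin> ?K" using disj z by blast
    then have "?K \<subseteq> P - {z}" using sub by blast
    then show "q \<in> component (P - {z}) p"
      using face_connectedD[OF face_connected_comp[of d "P - {c}"]] d dc pq by blast
    show "(p $ u - z $ u) * (q $ u - z $ u) < 0" using pq(3) side[OF z] by simp
  qed
qed

lemma double_edge_two_sided:
  assumes "double_edge c d u w" "z \<in> P"
  shows "two_sided z"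
proof -
  have "z \<in> component (P - {c}) d \<union> component (P - {d}) c"
    using edge_cover[of c d] assms unfolding double_edge_def by blast
  then show ?thesis
    using double_edge_half(2)[OF assms(1)] double_edge_half(2)[OF assms(1)[unfolded double_edge_sym[of c]]]
    by blast
qed

text \<open>\<open>Q\<close> extends from \<open>e\<close> in the direction \<open>s\<close> along
  \<open>w\<close>, and the pilar starts in the direction \<open>-s\<close>; both are reached from
  \<open>e\<close> without passing \<open>m\<close>, which lies from \<open>e\<close> in the
  direction of \<open>e'\<close>.\<close>

lemma arm_opposite_pair:
  assumes arm: "arm_with_pilar a b u v w e e' Q L" and "Q \<subseteq> P" "L \<subseteq> P" "e \<in> P" "distinct [u, v, w]"
    and m: "on_line v m e" "(m $ v - e $ v) * (e' $ v - e $ v) > 0"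
  shows "\<exists>p\<in>component (P - {m}) e. \<exists>q\<in>component (P - {m}) e. (p $ w - m $ w) * (q $ w - m $ w) < 0"
proof -
  obtain s g where Q: "planar_corner u e Q" "\<forall>x\<in>Q. (x $ v - e $ v) * (e' $ v - e $ v) \<le> 0" "extent w Q \<ge> 2"
    and s: "s \<in> {1, -1}" "\<forall>x\<in>Q. s * (x $ w - e $ w) \<ge> 0"
    and L: "pilar a b w (e - axis w s) g L"
    using arm unfolding arm_with_pilar_def by blast
  have eQ: "e \<in> Q" "face_connected Q"
    using Q(1) unfolding planar_corner_def minimal_inscribed_def polyomino_def by auto
  have mw: "m $ w = e $ w" using m(1) assms(5) unfolding on_line_def by auto
  have "m \<notin> Q" using Q(2) m(2) by fastforce
  then have "Q \<subseteq> P - {m}" using assms(2) by blast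
  then have in_comp: "x \<in> component (P - {m}) e" if "x \<in> Q" for x
    using face_connectedD[OF eQ(2) _ eQ(1) that] by blast
  have "finite Q" using assms(2) finite finite_subset by blast
  then obtain p where p: "p \<in> Q" "p $ w \<noteq> e $ w" using extent_ge_2 eQ(1) Q(3) by blast
  then have ps: "s * (p $ w - e $ w) > 0" using s by (auto simp: order_le_less)
  define f where "f = e - axis w s"
  have f: "f $ w = e $ w - s" "\<And>l. l \<noteq> w \<Longrightarrow> f $ l = e $ l" unfolding f_def by (auto simp: axis_def)
  have "f \<in> L" using L unfolding pilar_def f_def[symmetric] Box_def by auto
  moreover have "adjacent e f" using f s unfolding adjacent_def by (intro exI[of _ w]) auto
  moreover have "f \<noteq> m" using f(1) mw s by auto
  moreover have "e \<noteq> m" using m(2) by auto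
  ultimately have "f \<in> component (P - {m}) e"
    using component_step[OF component_self, of e "P - {m}" f] assms by blast
  moreover have "(p $ w - m $ w) * (f $ w - m $ w) < 0"
    using f(1) mw ps s(1) by auto
  ultimately show ?thesis using in_comp[OF p(1)] by blast
qed

lemma two_by_two_double_edge:
  assumes "two_by_two a b P"
  shows "\<exists>c d u w. double_edge c d u w"
proof -
  obtain u v w e1 e2 Q1 L1 Q2 L2 where uvw: "distinct [u, v, w]" and e: "e1 \<noteq> e2" "on_line v e1 e2"
    and arms: "arm_with_pilar a b u v w e1 e2 Q1 L1" "arm_with_pilar a b w v u e2 e1 Q2 L2"
    and P: "P = Box e1 e2 \<union> Q1 \<union> L1 \<union> Q2 \<union> L2"
    using assms unfolding two_by_two_def by (elim conjE exE) (rule that)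
  define r where "r = sgn (e2 $ v - e1 $ v)"
  have "e2 $ v \<noteq> e1 $ v" using e unfolding on_line_def by (metis vec_eq_iff)
  then have r: "(r = 1 \<and> e2 $ v - e1 $ v > 0) \<or> (r = -1 \<and> e2 $ v - e1 $ v < 0)" unfolding r_def by (auto simp: sgn_if)
  \<comment> \<open>The cell of the segment next to \<open>e1\<close>, possibly \<open>e2\<close>
    itself; the edge between \<open>e1\<close> and \<open>m\<close> is the double edge.\<close>
  define m where "m = e1 + axis v r"
  have m: "m $ v = e1 $ v + r" "\<And>l. l \<noteq> v \<Longrightarrow> m $ l = e1 $ l" unfolding m_def by (auto simp: axis_def)
  have line: "on_line v e1 m" unfolding on_line_def using m(2) by auto
  have "(m $ v - e1 $ v) * (m $ v - e2 $ v) \<le> 0" using m(1) r by (auto simp: mult_le_0_iff)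
  then have "m \<in> Box e1 e2" using Box_line[OF e(2)] line by blast
  then have mP: "m \<in> P" using P by blast
  have eP: "e1 \<in> P" "e2 \<in> P" using P unfolding Box_def by auto
  have adj: "adjacent e1 m" by (rule on_line_adjacent[OF line]) (use m r in auto)
  have "e2 \<in> component (P - {e1}) m"
    using separation[OF eP(1) mP eP(2), of r v] m(1) r by auto
  then have eq: "component (P - {e1}) e2 = component (P - {e1}) m" by (rule component_eq)
  have "distinct [w, v, u]" using uvw by auto
  moreover have "(e1 $ v - e2 $ v) * (e1 $ v - e2 $ v) > 0"
    using r by (auto simp: zero_less_mult_iff)
  ultimately have "\<exists>p\<in>component (P - {e1}) m. \<exists>q\<in>component (P - {e1}) m. (p $ u - e1 $ u) * (q $ u - e1 $ u) < 0"
    using arm_opposite_pair[OF arms(2), of e1] P eP e(2) unfolding eq by blast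
  moreover have "(m $ v - e1 $ v) * (e2 $ v - e1 $ v) > 0"
    using r m(1) by (auto simp: zero_less_mult_iff)
  then have "\<exists>p\<in>component (P - {m}) e1. \<exists>q\<in>component (P - {m}) e1. (p $ w - m $ w) * (q $ w - m $ w) < 0"
    using arm_opposite_pair[OF arms(1), of m] P eP uvw line on_line_sym by blast
  ultimately have "double_edge e1 m u w" unfolding double_edge_def using eP mP adj by blast
  then show ?thesis by blast
qed

text \<open>
  Among all components of some \<open>P - {c}\<close> with cells on both sides of \<open>c\<close>, one of minimal size
  yields a double edge.
\<close>

lemma two_sided_double_edge:
  assumes "\<And>c. c \<in> P \<Longrightarrow> two_sided c"
  shows "\<exists>c d u w. double_edge c d u w"
proof -
  define R where "R = (\<lambda>(c, x). c \<in> P \<and> x \<in> P \<and> x \<noteq> c \<and>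
    (\<exists>l. \<exists>q\<in>component (P - {c}) x. (x $ l - c $ l) * (q $ l - c $ l) < 0))"
  have ex: "\<exists>x. R (c, x)" if c: "c \<in> P" for c
  proof -
    obtain l x q where xq: "x \<in> P" "q \<in> component (P - {c}) x" "x $ l > c $ l" "q $ l < c $ l"
      using assms[OF c] unfolding two_sided_def linked_def by auto
    then have "(x $ l - c $ l) * (q $ l - c $ l) < 0" by (simp add: mult_less_0_iff)
    then show ?thesis unfolding R_def using c xq by (intro exI[of _ x]) auto
  qed
  then obtain cx where "R cx" using nonempty by blast
  from ex_has_least_nat[of R cx "\<lambda>(c, x). card (component (P - {c}) x)", OF this]
  obtain c x where R: "R (c, x)"
    and least: "\<And>c' x'. R (c', x') \<Longrightarrow> card (component (P - {c}) x) \<le> card (component (P - {c'}) x')"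
    by auto
  then obtain l q where c: "c \<in> P" and x: "x \<in> P" "x \<noteq> c" and q: "q \<in> component (P - {c}) x"
    "(x $ l - c $ l) * (q $ l - c $ l) < 0" unfolding R_def by blast
  obtain d where d: "d \<in> P" "adjacent c d" "x \<in> component (P - {c}) d"
    using component_has_neighbour[OF c x] .
  let ?K = "component (P - {c}) d" and ?K' = "component (P - {d}) c"
  have eq: "component (P - {c}) x = ?K" by (rule component_eq[OF d(3)])
  have dc: "d \<noteq> c" using d adjacent_neq by blast
  have sub: "?K \<subseteq> P - {c}" using component_sub d dc by blast
  then have fin: "finite ?K" using finite finite_subset by blast
  obtain y where y: "R (d, y)" using ex[OF d(1)] by blast
  then obtain k z where yz: "y \<in> P" "y \<noteq> d" "z \<in> component (P - {d}) y" "(y $ k - d $ k) * (z $ k - d $ k) < 0"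
    unfolding R_def by blast
  \<comment> \<open>A component at \<open>d\<close> other than that of \<open>c\<close> would lie
    inside \<open>?K\<close> without \<open>d\<close>, against the minimal size.\<close>
  have "y \<in> ?K'"
  proof (rule ccontr)
    assume "y \<notin> ?K'"
    then have "component (P - {d}) y \<inter> ?K' = {}" using component_sym component_trans by (metis disjoint_iff)
    moreover have "component (P - {d}) y \<subseteq> P - {d}" using component_sub yz by blast
    ultimately have "component (P - {d}) y \<subseteq> ?K - {d}" using edge_cover[OF c d(1,2)] by blast
    then have "component (P - {d}) y \<subset> ?K" using component_self[of d] by blast
    then have "card (component (P - {d}) y) < card ?K" using fin by (rule psubset_card_mono[rotated])
    then show False using least[OF y] eq by simp
  qed
  then have "component (P - {d}) y = ?K'" by (rule component_eq)
  then have "double_edge c d l k"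
    unfolding double_edge_def using c d q yz \<open>y \<in> ?K'\<close> unfolding eq by blast
  then show ?thesis by blast
qed

text \<open>By \<open>edge_side\<close> both sides of the edge are one-sided along \<open>v\<close>,
  which excludes \<open>u\<close> and \<open>w\<close>. The side of \<open>c\<close> is flat along
  \<open>u\<close> but not along \<open>w\<close>.\<close>

lemma double_edge_axes:
  assumes "double_edge c d u w" "on_line v c d"
  shows "distinct [u, v, w]"
proof -
  let ?K = "component (P - {c}) d" and ?K' = "component (P - {d}) c"
  have neq: "u \<noteq> v" if "double_edge c d u w" "on_line v c d" for c d u w
  proof
    assume "u = v"
    obtain p q where pq: "c \<in> P" "d \<in> P" "adjacent c d" "p \<in> component (P - {c}) d" "q \<in> component (P - {c}) d"
      "(p $ u - c $ u) * (q $ u - c $ u) < 0" using \<open>double_edge c d u w\<close> unfolding double_edge_def by blast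
    have "d $ v \<noteq> c $ v" using adjacent_neq[OF pq(3)] that(2) unfolding on_line_def by (metis vec_eq_iff)
    moreover have "(p $ v - d $ v) * (d $ v - c $ v) \<ge> 0" "(q $ v - d $ v) * (d $ v - c $ v) \<ge> 0"
      using edge_side[OF pq(1-3)] pq by auto
    ultimately show False using pq(6) \<open>u = v\<close> by (auto simp: zero_le_mult_iff mult_less_0_iff)
  qed
  have uv: "u \<noteq> v" using neq assms by blast
  moreover have "w \<noteq> v" using neq[of d c w u] assms double_edge_sym on_line_sym by blast
  moreover have "u \<noteq> w"
  proof
    assume "u = w"
    obtain p where "p \<in> ?K'" "p $ w \<noteq> d $ w" using assms(1) unfolding double_edge_def
      by (metis diff_self mult_zero_left order_less_irrefl)
    moreover have "d $ w = c $ w" using assms(2) uv \<open>u = w\<close> unfolding on_line_def by auto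
    ultimately show False using double_edge_half(1)[OF assms(1)] \<open>u = w\<close> by auto
  qed
  ultimately show ?thesis by auto
qed

section \<open>Segment, arms and pilars from a double edge\<close>

text \<open>By separation the component contains a cell of \<open>P\<close> that is extreme in its
  direction, so the row reaches a face of the prism; connectedness leaves no gap from the cell next
  to \<open>c\<close>.\<close>

lemma pilar_component:
  assumes ins: "inscribed a b P" and c: "c \<in> P" and q: "q \<in> P" "s * (q $ w - c $ w) < 0" and s: "s = 1 \<or> s = -1"
    and line: "\<And>x. x \<in> component (P - {c}) q \<Longrightarrow> on_line w c x \<and> s * (x $ w - c $ w) < 0"
  shows "\<exists>g. s * (g $ w - (c - axis w s) $ w) \<le> 0 \<and> pilar a b w (c - axis w s) g (component (P - {c}) q)"
proof -
  let ?L = "component (P - {c}) q"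
  define f where "f = c - axis w s"
  have f: "f $ w = c $ w - s" "\<And>l. l \<noteq> w \<Longrightarrow> f $ l = c $ l" unfolding f_def by (auto simp: axis_def)
  have qc: "q \<noteq> c" using q by auto
  obtain f0 where f0: "f0 \<in> P" "adjacent c f0" "q \<in> component (P - {c}) f0"
    using component_has_neighbour[OF c q(1) qc] .
  have f0L: "f0 \<in> ?L" using f0(3) component_sym by blast
  have "f0 $ w = f $ w"
    using adjacent_step[OF f0(2), of w] line[OF f0L] f(1) s by auto
  moreover have "f0 $ l = f $ l" if "l \<noteq> w" for l using line[OF f0L] f(2) that unfolding on_line_def by auto
  ultimately have "f0 = f" by (metis vec_eq_iff)
  then have fL: "f \<in> ?L" using f0L by simp
  have "\<exists>g\<in>P. g $ w \<in> {a $ w, b $ w} \<and> (\<forall>x\<in>P. s * (g $ w - x $ w) \<le> 0)"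
  proof -
    have box: "min (a $ w) (b $ w) \<le> x $ w" "x $ w \<le> max (a $ w) (b $ w)" if "x \<in> P" for x
      using ins that unfolding inscribed_def Box_def by auto
    obtain x y where xy: "x \<in> P" "x $ w = a $ w" "y \<in> P" "y $ w = b $ w"
      using ins unfolding inscribed_def by blast
    have "(\<forall>z\<in>P. s * (x $ w - z $ w) \<le> 0) \<or> (\<forall>z\<in>P. s * (y $ w - z $ w) \<le> 0)"
      using box xy(2,4) s by (cases "a $ w \<le> b $ w") fastforce+
    then show ?thesis using xy by (metis insert_iff)
  qed
  then obtain g where g: "g \<in> P" "g $ w \<in> {a $ w, b $ w}" "\<And>x. x \<in> P \<Longrightarrow> s * (g $ w - x $ w) \<le> 0" by blast
  have "s * (g $ w - c $ w) < 0" using g(3)[OF q(1)] q(2) by (simp add: algebra_simps)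
  then have gL: "g \<in> ?L" using separation[OF c q(1) g(1), of "-s" w] q(2) by auto
  have fg: "on_line w f g" using line[OF gL] f(2) unfolding on_line_def by auto
  have con: "face_connected ?L" using face_connected_comp[of q "P - {c}"] q qc by blast
  have sg: "s * (g $ w - f $ w) \<le> 0" using line[OF gL] f(1) s by auto
  have "?L = Box f g"
  proof (intro equalityI subsetI)
    fix x assume x: "x \<in> ?L"
    have "on_line w f x" using line[OF x] f(2) unfolding on_line_def by auto
    moreover have "x \<in> P" using x component_sub[OF q(1) qc] by blast
    then have "(x $ w - f $ w) * (x $ w - g $ w) \<le> 0"
      using line[OF x] f(1) g(3)[of x] s by (auto simp: mult_le_0_iff)
    ultimately show "x \<in> Box f g" using Box_line[OF fg] by blast
  next
    fix x assume "x \<in> Box f g"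
    then have x: "on_line w f x" "(x $ w - f $ w) * (x $ w - g $ w) \<le> 0" using Box_line[OF fg] by auto
    obtain y where y: "y \<in> ?L" "y $ w = x $ w" using coords_between[OF con fL gL x(2)] by auto
    have "x $ l = y $ l" if "l \<noteq> w" for l
      using line[OF y(1)] x(1) f(2) that unfolding on_line_def by auto
    then have "x = y" using y(2) by (metis vec_eq_iff)
    then show "x \<in> ?L" using y by simp
  qed
  then show ?thesis unfolding f_def[symmetric] pilar_def using fg g sg by blast
qed

end

text \<open>For lengthening a segment by one cell: \<open>b\<close> is next to \<open>a\<close> on
  the way to \<open>e\<close>.\<close>

lemma between_extend_by_one:
  fixes a b e x :: int
  assumes "\<bar>b - a\<bar> = 1" "(e - b) * (a - b) \<le> 0"
  shows "(x - a) * (x - e) \<le> 0 \<longleftrightarrow> x = a \<or> (x - b) * (x - e) \<le> 0"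
proof -
  have "b = a + 1 \<and> b \<le> e \<or> b = a - 1 \<and> e \<le> b" using assms unfolding mult_le_0_iff by linarith
  then show ?thesis unfolding mult_le_0_iff by auto
qed

lemma finite_Box: "finite (Box a b)"
proof (rule finite_subset)
  let ?F = "Pi\<^sub>E UNIV (\<lambda>i. {min (a $ i) (b $ i)..max (a $ i) (b $ i)})"
  show "Box a b \<subseteq> vec_lambda ` ?F"
  proof
    fix x assume "x \<in> Box a b"
    then have "vec_nth x \<in> ?F" unfolding Box_def by auto
    then show "x \<in> vec_lambda ` ?F" by (intro image_eqI[of _ _ "vec_nth x"]) (auto simp: vec_eq_iff)
  qed
  show "finite (vec_lambda ` ?F)" by (intro finite_imageI finite_PiE) auto
qed

context minimal_polyomino
begin

lemma component_sub_component:
  assumes c: "c \<in> P" and x: "x \<in> P" "x \<noteq> c" and d: "c \<noteq> d" "d \<notin> component (P - {c}) x"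
  shows "insert c (component (P - {c}) x) \<subseteq> component (P - {d}) c"
proof
  fix y assume y: "y \<in> insert c (component (P - {c}) x)"
  have "component (P - {c}) x \<subseteq> P - {c}" by (rule component_sub[OF x])
  then have "insert c (component (P - {c}) x) \<subseteq> P - {d}" using c d by blast
  then show "y \<in> component (P - {d}) c"
    using face_connectedD[OF component_insert_connected[OF c x]] y by blast
qed

text \<open>The end of the segment: \<open>p\<close> and \<open>q\<close> lie on different sides of
  \<open>c\<close> and in different components. That of \<open>q\<close>, flat along
  \<open>u\<close> and \<open>v\<close>, is a row and becomes the pilar; the rest of this side of
  the edge becomes the planar corner-polyomino.\<close>

lemma end_arm:
  assumes ins: "inscribed a b P" and de: "double_edge c d u w" and line: "on_line v c d"
    and p: "p \<in> component (P - {d}) c" "s * (p $ w - c $ w) > 0"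
    and q: "q \<in> component (P - {d}) c" "s * (q $ w - c $ w) < 0"
    and s: "s = 1 \<or> s = -1" and pq: "q \<notin> component (P - {c}) p"
    and flat: "\<And>x. x \<in> component (P - {c}) q \<Longrightarrow> x $ v = c $ v"
    and e': "(e' $ v - c $ v) * (d $ v - c $ v) > 0"
  shows "arm_with_pilar a b u v w c e' (component (P - {d}) c - component (P - {c}) q) (component (P - {c}) q)"
    and "component (P - {c}) q \<subseteq> component (P - {d}) c - {c}"
proof -
  let ?K = "component (P - {c}) d" and ?K' = "component (P - {d}) c" and ?L = "component (P - {c}) q"
  define Q where "Q = ?K' - ?L"
  have uvw: "distinct [u, v, w]" by (rule double_edge_axes[OF de line])
  have c: "c \<in> P" and d: "d \<in> P" "adjacent c d" using de unfolding double_edge_def by auto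
  have dc: "d \<noteq> c" using d adjacent_neq by blast
  have sub: "?K \<subseteq> P - {c}" "?K' \<subseteq> P - {d}" using component_sub c d dc by auto
  have disj: "?K \<inter> ?K' = {}" by (rule edge_disjoint[OF c d])
  have pq_neq: "p \<noteq> c" "q \<noteq> c" using p q by auto
  have pqP: "p \<in> P" "q \<in> P" using p q sub by auto
  have u: "x $ u = c $ u" if "x \<in> ?K'" for x by (rule double_edge_half(1)[OF de that])
  have v: "(x $ v - c $ v) * (c $ v - d $ v) \<ge> 0" if "x \<in> ?K'" for x
    using edge_side[OF d(1) c _ that] d(2) adjacent_sym by blast
  have not_d: "d \<notin> component (P - {c}) x" if "x \<in> ?K'" for x
    using that disj component_sym by blast
  have into: "component (P - {c}) x \<subseteq> ?K'" if "x \<in> ?K'" "x \<noteq> c" for x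
    using component_sub_component[OF c _ that(2) _ not_d[OF that(1)]] dc sub that(1) by blast
  have LP: "?L \<subseteq> P - {c}" by (rule component_sub[OF pqP(2) pq_neq(2)])
  then show L: "?L \<subseteq> ?K' - {c}" using into[OF q(1) pq_neq(2)] by blast
  have Lw: "s * (x $ w - c $ w) < 0" if "x \<in> ?L" for x
  proof -
    have "x $ l = c $ l" if "l \<noteq> w" for l
      using distinct_3_cases[OF uvw, of l] that u flat[OF \<open>x \<in> ?L\<close>] L \<open>x \<in> ?L\<close> by auto
    then have "x $ w \<noteq> c $ w" using LP \<open>x \<in> ?L\<close> by (metis DiffE insertI1 subsetD vec_eq_iff)
    moreover have "\<not> s * (x $ w - c $ w) > 0"
    proof
      assume "s * (x $ w - c $ w) > 0"
      then have "x \<in> component (P - {c}) p" using separation[OF c pqP(1)] p(2) LP that by blast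
      then show False using pq that component_sym component_trans by metis
    qed
    ultimately show ?thesis using s by auto
  qed
  have "on_line w c x" if "x \<in> ?L" for x
    unfolding on_line_def
  proof (intro allI impI)
    fix l assume "l \<noteq> w"
    then show "c $ l = x $ l"
      using distinct_3_cases[OF uvw, of l] u[of x] flat[OF that] L that by auto
  qed
  then obtain g where g: "s * (g $ w - (c - axis w s) $ w) \<le> 0" "pilar a b w (c - axis w s) g ?L"
    using pilar_component[OF ins c pqP(2) q(2) s] Lw by blast
  have QP: "Q \<subseteq> P" unfolding Q_def using sub by blast
  have cQ: "c \<in> Q" unfolding Q_def using component_self L by blast
  have fin: "finite Q" using QP finite finite_subset by blast
  have Qw: "s * (x $ w - c $ w) \<ge> 0" if "x \<in> Q" for x
  proof (rule ccontr)
    assume "\<not> ?thesis"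
    then have "x \<in> ?L" using separation[OF c pqP(2), of x "-s" w] q(2) QP that by auto
    then show False using that unfolding Q_def by blast
  qed
  have con: "face_connected Q"
  proof (rule face_connectedI[of _ c])
    fix x assume x: "x \<in> Q"
    show "x \<in> component Q c"
    proof (cases "x = c")
      case True then show ?thesis by (simp add: component_self)
    next
      case False
      have "component (P - {c}) x \<inter> ?L = {}"
        using x component_sym component_trans unfolding Q_def by (metis DiffE disjoint_iff)
      then have "insert c (component (P - {c}) x) \<subseteq> Q"
        using into[of x] x False cQ unfolding Q_def by blast
      then show ?thesis
        using face_connectedD[OF component_insert_connected[OF c _ False], of Q c x] x QP component_self by blast
    qed
  qed
  have "\<exists>t. t \<noteq> 0 \<and> (\<forall>x\<in>Q. t * (x $ l - c $ l) \<ge> 0)" for l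
  proof -
    consider "l = u" | "l = v" | "l = w" using distinct_3_cases[OF uvw] by blast
    then show ?thesis
    proof cases
      case 1
      then show ?thesis using u unfolding Q_def by (intro exI[of _ 1]) auto
    next
      case 2
      have "c $ v - d $ v \<noteq> 0" using e' by auto
      then show ?thesis using v 2 unfolding Q_def by (intro exI[of _ "c $ v - d $ v"]) (auto simp: mult.commute)
    next
      case 3
      then show ?thesis using Qw s by (intro exI[of _ s]) auto
    qed
  qed
  then have "\<exists>d'. minimal_inscribed c d' Q" using corner_inscribed[OF QP con cQ] by blast
  moreover have "Q \<subseteq> layer u (c $ u)" using u unfolding layer_def Q_def by blast
  ultimately have "planar_corner u c Q" unfolding planar_corner_def using cQ by blast
  moreover have "(x $ v - c $ v) * (e' $ v - c $ v) \<le> 0" if "x \<in> Q" for x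
    using v[of x] e' that unfolding Q_def
    by (auto simp: zero_le_mult_iff mult_le_0_iff zero_less_mult_iff)
  moreover have "extent w Q \<ge> 2"
  proof -
    have "p \<in> Q" unfolding Q_def using p(1) pq component_sym by blast
    moreover have "p $ w \<noteq> c $ w" using p(2) by auto
    ultimately show ?thesis using extent_ge_2[OF fin cQ] by blast
  qed
  ultimately show "arm_with_pilar a b u v w c e' (?K' - ?L) ?L"
    unfolding arm_with_pilar_def Q_def[symmetric] using g Qw s by blast
qed

text \<open>
  As long as one component of \<open>P - {c}\<close> contains cells on both sides of \<open>c\<close> along \<open>w\<close>, the straight
  segment continues beyond \<open>c\<close>; the induction moves \<open>c\<close> to its end.
\<close>

lemma double_edge_arm:
  assumes ins: "inscribed a b P" and "double_edge c d u w" "on_line v c d"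
  shows "\<exists>e Q L. on_line v c e \<and> (e $ v - c $ v) * (d $ v - c $ v) \<le> 0 \<and>
    component (P - {d}) c = Box c e \<union> Q \<union> L \<and>
    (\<forall>e'. (e' $ v - e $ v) * (d $ v - c $ v) > 0 \<longrightarrow> arm_with_pilar a b u v w e e' Q L)"
  \<comment> \<open>The far end of the segment lies beyond \<open>d\<close> and is not known here,
    so the arm is claimed for every \<open>e'\<close> in the right direction.\<close>
  using assms(2,3)
proof (induction "card (component (P - {d}) c)" arbitrary: c d rule: less_induct)
  case less
  note de = less.prems(1) and line = less.prems(2)
  let ?K = "component (P - {c}) d" and ?K' = "component (P - {d}) c"
  have uvw: "distinct [u, v, w]" by (rule double_edge_axes[OF de line])
  have c: "c \<in> P" and d: "d \<in> P" "adjacent c d" using de unfolding double_edge_def by auto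
  have dc: "d \<noteq> c" using d adjacent_neq by blast
  have sub: "?K \<subseteq> P - {c}" "?K' \<subseteq> P - {d}" using component_sub c d dc by auto
  have disj: "?K \<inter> ?K' = {}" by (rule edge_disjoint[OF c d])
  have dw: "d $ w = c $ w" using line uvw unfolding on_line_def by auto
  have u: "x $ u = c $ u" if "x \<in> ?K'" for x by (rule double_edge_half(1)[OF de that])
  have v: "(x $ v - c $ v) * (c $ v - d $ v) \<ge> 0" if "x \<in> ?K'" for x
    using edge_side[OF d(1) c _ that] d(2) adjacent_sym by blast
  obtain p q where pq: "p \<in> ?K'" "q \<in> ?K'" "(p $ w - c $ w) * (q $ w - c $ w) < 0"
    using de dw unfolding double_edge_def by auto
  have pq_neq: "p \<noteq> c" "q \<noteq> c" using pq(3) by auto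
  have pqP: "p \<in> P" "q \<in> P" using pq sub by auto
  have unit: "\<bar>d $ v - c $ v\<bar> = 1"
  proof -
    obtain l where "on_line l c d" "\<bar>d $ l - c $ l\<bar> = 1" using adjacent_on_line[OF d(2)] .
    then show ?thesis using line unfolding on_line_def by (cases "l = v") auto
  qed
  show ?case
  proof (cases "q \<in> component (P - {c}) p")
    case True
    obtain c' where c': "c' \<in> P" "adjacent c c'" "p \<in> component (P - {c}) c'"
      using component_has_neighbour[OF c pqP(1) pq_neq(1)] .
    let ?Y = "component (P - {c}) c'"
    have c'c: "c' \<noteq> c" using c' adjacent_neq by blast
    have qY: "q \<in> ?Y" using True c'(3) component_trans by blast
    have "?K \<inter> ?Y = {}"
    proof (rule ccontr)
      assume "?K \<inter> ?Y \<noteq> {}"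
      then have "p \<in> ?K" using c'(3) component_sym component_trans by (metis disjoint_iff)
      then show False using pq(1) disj by blast
    qed
    then have dY: "d \<notin> ?Y" "c' \<notin> ?K" using component_self by blast+
    have YK: "insert c ?Y \<subseteq> ?K'"
      by (rule component_sub_component[OF c c'(1) c'c _ dY(1)]) (use dc in blast)
    have c'K: "c' \<in> ?K'" using YK component_self by blast
    obtain k where k: "on_line k c c'" "\<bar>c' $ k - c $ k\<bar> = 1" using adjacent_on_line[OF c'(2)] .
    \<comment> \<open>The next cell continues straight: axis \<open>u\<close> is excluded by
      flatness, axis \<open>w\<close> because \<open>p\<close> and \<open>q\<close> both lie beyond
      \<open>c'\<close> but on different sides of \<open>c\<close>.\<close>
    have "k \<noteq> u" using u[OF c'K] k(2) by auto
    moreover have "k \<noteq> w"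
    proof
      assume "k = w"
      have "(p $ w - c' $ w) * (c' $ w - c $ w) \<ge> 0" "(q $ w - c' $ w) * (c' $ w - c $ w) \<ge> 0"
        using edge_side[OF c c'(1,2)] c'(3) qY by auto
      then show False using pq(3) k(2) \<open>k = w\<close> by (auto simp: zero_le_mult_iff mult_less_0_iff)
    qed
    ultimately have "k = v" using distinct_3_cases[OF uvw, of k] by blast
    have line': "on_line v c' c" using k(1) \<open>k = v\<close> on_line_sym by blast
    then have step: "c $ v - c' $ v = d $ v - c $ v"
      using v[OF c'K] k(2) \<open>k = v\<close> unit unfolding zero_le_mult_iff by auto
    have de': "double_edge c' c u w"
    proof -
      obtain p' q' where pq': "p' \<in> ?K" "q' \<in> ?K" "(p' $ u - c $ u) * (q' $ u - c $ u) < 0"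
        using de unfolding double_edge_def by blast
      have "insert c ?K \<subseteq> component (P - {c'}) c"
        by (rule component_sub_component[OF c d(1) dc _ dY(2)]) (use c'c in blast)
      then have "p' \<in> component (P - {c'}) c" "q' \<in> component (P - {c'}) c" using pq' by auto
      moreover have "(p' $ u - c' $ u) * (q' $ u - c' $ u) < 0" using pq'(3) u[OF c'K] by simp
      ultimately show ?thesis
        unfolding double_edge_def using c c'(1,2) adjacent_sym c'(3) qY pq(3) by blast
    qed
    \<comment> \<open>Other cells on this side of the edge differ from \<open>c\<close> along
      \<open>w\<close>, and belong to the component of \<open>p\<close> and \<open>q\<close>, or
      along \<open>v\<close>, and share the direction of \<open>c'\<close>.\<close>
    have K': "?K' = insert c ?Y"
    proof
      show "?K' \<subseteq> insert c ?Y"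
      proof
        fix x assume x: "x \<in> ?K'"
        have xP: "x \<in> P" using x sub by blast
        show "x \<in> insert c ?Y"
        proof (cases "x $ w = c $ w")
          case False
          then have "x \<in> component (P - {c}) p"
            using separation_opposite[OF c pqP(1) True pq(3) xP] by blast
          then show ?thesis using c'(3) component_trans by blast
        next
          case w: True
          show ?thesis
          proof (cases "x $ v = c $ v")
            case True
            then have "x $ l = c $ l" for l using distinct_3_cases[OF uvw, of l] w u[OF x] by auto
            then show ?thesis by (simp add: vec_eq_iff)
          next
            case False
            have "(c' $ v - c $ v) * (x $ v - c $ v) > 0"
              using v[OF x] step False unit
              by (auto simp: zero_le_mult_iff zero_less_mult_iff)
            moreover have "(c' $ v - c $ v) * (c' $ v - c $ v) > 0"
              using k(2) \<open>k = v\<close> by (auto simp: zero_less_mult_iff)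
            ultimately show ?thesis using separation[OF c c'(1) xP] by blast
          qed
        qed
      qed
    qed (rule YK)
    have "c \<notin> ?Y" using component_sub[OF c'(1) c'c] by blast
    moreover have "finite ?Y" using component_sub[OF c'(1) c'c] finite finite_subset by blast
    ultimately have "card ?Y < card ?K'" unfolding K' by simp
    from less.hyps[OF this de' line'] obtain e Q L where e: "on_line v c' e"
      "(e $ v - c' $ v) * (c $ v - c' $ v) \<le> 0" "?Y = Box c' e \<union> Q \<union> L"
      "\<And>e'. (e' $ v - e $ v) * (c $ v - c' $ v) > 0 \<Longrightarrow> arm_with_pilar a b u v w e e' Q L" by blast
    have ce: "on_line v c e" using line' e(1) unfolding on_line_def by auto
    have "Box c e = insert c (Box c' e)"
    proof -
      have "x \<in> Box c e \<longleftrightarrow> x \<in> insert c (Box c' e)" for x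
      proof -
        have "x = c \<longleftrightarrow> on_line v c x \<and> x $ v = c $ v" unfolding on_line_def vec_eq_iff by metis
        moreover have "on_line v c x \<longleftrightarrow> on_line v c' x" using line' unfolding on_line_def by auto
        moreover have "(x $ v - c $ v) * (x $ v - e $ v) \<le> 0 \<longleftrightarrow>
            x $ v = c $ v \<or> (x $ v - c' $ v) * (x $ v - e $ v) \<le> 0"
          using between_extend_by_one[of "c' $ v" "c $ v" "e $ v" "x $ v"] e(2) k(2) \<open>k = v\<close> by simp
        ultimately show ?thesis using Box_line[OF ce] Box_line[OF e(1)] by blast
      qed
      then show ?thesis by blast
    qed
    then have "?K' = Box c e \<union> Q \<union> L" using K' e(3) by blast
    moreover have "(e $ v - c $ v) * (d $ v - c $ v) \<le> 0"
      using e(2) step k(2) \<open>k = v\<close> unfolding mult_le_0_iff by linarith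
    ultimately show ?thesis using ce e(4) unfolding step by blast
  next
    case False
    \<comment> \<open>Kept general in \<open>p\<close> and \<open>q\<close>, as their roles may have
      to be exchanged.\<close>
    have arm: ?thesis
      if p: "p \<in> ?K'" and q: "q \<in> ?K'" and pq: "(p $ w - c $ w) * (q $ w - c $ w) < 0"
        and no: "q \<notin> component (P - {c}) p"
        and flat: "\<And>x. x \<in> component (P - {c}) q \<Longrightarrow> x $ v = c $ v" for p q
    proof -
      define s where "s = sgn (p $ w - c $ w)"
      have s: "s = 1 \<or> s = -1" "s * (p $ w - c $ w) > 0" "s * (q $ w - c $ w) < 0"
        using pq unfolding s_def by (auto simp: sgn_if mult_less_0_iff)
      let ?L = "component (P - {c}) q"
      have "arm_with_pilar a b u v w c e' (?K' - ?L) ?L" if "(e' $ v - c $ v) * (d $ v - c $ v) > 0" for e'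
        by (rule end_arm(1)[OF ins de line p s(2) q s(3) s(1) no flat that])
      then have arms: "\<forall>e'. (e' $ v - c $ v) * (d $ v - c $ v) > 0 \<longrightarrow>
          arm_with_pilar a b u v w c e' (?K' - ?L) ?L" by blast
      have "?L \<subseteq> ?K' - {c}"
      proof -
        have "(d $ v - c $ v) * (d $ v - c $ v) > 0"
          using unit unfolding zero_less_mult_iff by linarith
        then show ?thesis using end_arm(2)[OF ins de line p s(2) q s(3) s(1) no flat] by blast
      qed
      moreover have "Box c c = {c}" by (auto simp: Box_def vec_eq_iff order_eq_iff)
      moreover have "c \<in> ?K'" by (rule component_self)
      ultimately have "?K' = Box c c \<union> (?K' - ?L) \<union> ?L" by auto
      moreover have "on_line v c c" unfolding on_line_def by simp
      ultimately show ?thesis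
        using arms by (intro exI[of _ c] exI[of _ "?K' - ?L"] exI[of _ ?L] conjI) (assumption | simp)+
    qed
    show ?thesis
    proof (cases "\<forall>x\<in>component (P - {c}) q. x $ v = c $ v")
      case True
      then show ?thesis using arm[OF pq False] by blast
    next
      case notflat: False
      then obtain y where y: "y \<in> component (P - {c}) q" "y $ v \<noteq> c $ v" by blast
      have not_d: "d \<notin> component (P - {c}) x" if "x \<in> ?K'" for x
        using that disj component_sym by blast
      have into: "component (P - {c}) x \<subseteq> ?K'" if "x \<in> ?K'" "x \<noteq> c" for x
        using component_sub_component[OF c _ that(2) _ not_d[OF that(1)]] dc sub that(1) by blast
      \<comment> \<open>If both components left the layer of \<open>c\<close> along
        \<open>v\<close>, they would do so in the same direction, away from \<open>d\<close>, and
        separation would merge them.\<close>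
      have "x $ v = c $ v" if x: "x \<in> component (P - {c}) p" for x
      proof (rule ccontr)
        assume "x $ v \<noteq> c $ v"
        have xy: "x \<in> ?K'" "y \<in> ?K'" using into pq(1,2) pq_neq x y by blast+
        have "(y $ v - c $ v) * (x $ v - c $ v) > 0" "(y $ v - c $ v) * (y $ v - c $ v) > 0"
          using v[OF xy(1)] v[OF xy(2)] y(2) \<open>x $ v \<noteq> c $ v\<close> unit
          unfolding zero_le_mult_iff zero_less_mult_iff by linarith+
        moreover have "x \<in> P" "y \<in> P" using xy sub by auto
        ultimately have "x \<in> component (P - {c}) y" using separation[OF c] by blast
        then show False using False x y(1) component_sym component_trans by metis
      qed
      moreover have "p \<notin> component (P - {c}) q" using False component_sym by blast
      ultimately show ?thesis using arm[of q p] pq by (simp add: mult.commute)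
    qed
  qed
qed

text \<open>\<open>double_edge_arm\<close> is applied on both sides of a double edge. The two
  half-segments join along this edge, and each arm takes the end of the other half as its
  \<open>e'\<close>.\<close>

lemma two_sided_two_by_two:
  assumes min: "minimal_inscribed a b P" and two: "\<And>c. c \<in> P \<Longrightarrow> two_sided c"
  shows "two_by_two a b P"
proof -
  have ins: "inscribed a b P" using min unfolding minimal_inscribed_def by blast
  obtain c d u w where de: "double_edge c d u w" using two_sided_double_edge[OF two] by blast
  have c: "c \<in> P" and d: "d \<in> P" "adjacent c d" using de unfolding double_edge_def by auto
  obtain v where line: "on_line v c d" "\<bar>d $ v - c $ v\<bar> = 1" using adjacent_on_line[OF d(2)] .
  have de': "double_edge d c w u" using de double_edge_sym by blast
  have line': "on_line v d c" using line(1) on_line_sym by blast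
  obtain e1 Q1 L1 where 1: "on_line v c e1" "(e1 $ v - c $ v) * (d $ v - c $ v) \<le> 0"
    "component (P - {d}) c = Box c e1 \<union> Q1 \<union> L1"
    "\<And>e'. (e' $ v - e1 $ v) * (d $ v - c $ v) > 0 \<Longrightarrow> arm_with_pilar a b u v w e1 e' Q1 L1"
    using double_edge_arm[OF ins de line(1)] by blast
  obtain e2 Q2 L2 where 2: "on_line v d e2" "(e2 $ v - d $ v) * (c $ v - d $ v) \<le> 0"
    "component (P - {c}) d = Box d e2 \<union> Q2 \<union> L2"
    "\<And>e'. (e' $ v - e2 $ v) * (c $ v - d $ v) > 0 \<Longrightarrow> arm_with_pilar a b w v u e2 e' Q2 L2"
    using double_edge_arm[OF ins de' line'] by blast
  have e12: "on_line v e1 e2" using 1(1) 2(1) line(1) unfolding on_line_def by auto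
  have order: "d $ v - c $ v = 1 \<and> e1 $ v \<le> c $ v \<and> d $ v \<le> e2 $ v \<or>
      d $ v - c $ v = -1 \<and> c $ v \<le> e1 $ v \<and> e2 $ v \<le> d $ v"
    using 1(2) 2(2) line(2) unfolding mult_le_0_iff by linarith
  have "(e2 $ v - e1 $ v) * (d $ v - c $ v) > 0" "(e1 $ v - e2 $ v) * (c $ v - d $ v) > 0"
    using order unfolding zero_less_mult_iff by linarith+
  then have arms: "arm_with_pilar a b u v w e1 e2 Q1 L1" "arm_with_pilar a b w v u e2 e1 Q2 L2"
    using 1(4) 2(4) by blast+
  have "x \<in> Box e1 e2 \<longleftrightarrow> x \<in> Box c e1 \<union> Box d e2" for x
  proof -
    have "on_line v e1 x \<longleftrightarrow> on_line v c x" "on_line v e1 x \<longleftrightarrow> on_line v d x"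
      using 1(1) 2(1) e12 unfolding on_line_def by auto
    moreover have "(x $ v - e1 $ v) * (x $ v - e2 $ v) \<le> 0 \<longleftrightarrow>
        (x $ v - c $ v) * (x $ v - e1 $ v) \<le> 0 \<or> (x $ v - d $ v) * (x $ v - e2 $ v) \<le> 0"
      using order unfolding mult_le_0_iff by linarith
    ultimately show ?thesis using Box_line[OF e12] Box_line[OF 1(1)] Box_line[OF 2(1)] by blast
  qed
  then have "Box e1 e2 = Box c e1 \<union> Box d e2" by blast
  then have "P = Box e1 e2 \<union> Q1 \<union> L1 \<union> Q2 \<union> L2"
    using edge_cover[OF c d] 1(3) 2(3) by blast
  moreover have "e1 \<noteq> e2" using order by auto
  ultimately show ?thesis
    unfolding two_by_two_def using min double_edge_axes[OF de line(1)] e12 arms by blast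
qed

end

section \<open>Exhaustion and disjointness of the families\<close>

lemma minimal_inscribed_cases:
  assumes "minimal_inscribed a b P"
  shows "diagonal a b P \<or> two_by_two a b P \<or> skew_cross a b P"
proof -
  interpret minimal_polyomino P using assms minimal_inscribed_iff by blast
  show ?thesis
  proof (cases "\<forall>c\<in>P. two_sided c")
    case True
    then show ?thesis using two_sided_two_by_two[OF assms] by blast
  next
    case False
    then obtain c where c: "c \<in> P" "\<not> two_sided c" by blast
    from c(1) show ?thesis
    proof (cases rule: cell_cases)
      case 1 then show ?thesis using c by blast
    next
      case (2 \<sigma>) then show ?thesis using coherent_diagonal[OF assms c(1)] by blast
    next
      case 3 then show ?thesis using skew_centre_skew_cross[OF assms c(1)] by blast
    qed
  qed
qed

text \<open>In the diagonal case \<open>A\<close>, \<open>B\<close> may differ from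
  \<open>a\<close>, \<open>b\<close>, but opposite corners span the same box with the same
  faces.\<close>

lemma families_minimal_inscribed:
  shows "diagonal a b P \<Longrightarrow> minimal_inscribed a b P"
    and "two_by_two a b P \<Longrightarrow> minimal_inscribed a b P"
    and "skew_cross a b P \<Longrightarrow> minimal_inscribed a b P"
proof -
  assume "diagonal a b P"
  then obtain A B where AB: "opposite_corners a b A B" "minimal_inscribed A B P"
    unfolding diagonal_def diagonal_along_def by blast
  have i: "A $ i = a $ i \<and> B $ i = b $ i \<or> A $ i = b $ i \<and> B $ i = a $ i" for i
    using AB(1) unfolding opposite_corners_def by (auto simp: doubleton_eq_iff)
  have "Box A B = Box a b"
  proof -
    have "min (A $ i) (B $ i) = min (a $ i) (b $ i) \<and> max (A $ i) (B $ i) = max (a $ i) (b $ i)" for i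
      using i[of i] by (auto simp: min.commute max.commute)
    then show ?thesis unfolding Box_def by simp
  qed
  then have "inscribed A B P \<longleftrightarrow> inscribed a b P" unfolding inscribed_def using i by metis
  then show "minimal_inscribed a b P" using AB(2) minimal_inscribed_iff by blast
qed (auto simp: two_by_two_def skew_cross_def)

text \<open>All cells of a 2D x 2D polyomino are two-sided, and all of a skew cross except its
  centre, where no signs are coherent; a diagonal polyomino has a coherent cell, which cannot be
  two-sided.\<close>

lemma families_disjoint:
  shows "\<not> (diagonal a b P \<and> two_by_two a b P)"
    and "\<not> (diagonal a b P \<and> skew_cross a b P)"
    and "\<not> (two_by_two a b P \<and> skew_cross a b P)"
proof -
  have P: "minimal_polyomino P" if "diagonal a b P \<or> two_by_two a b P"
    using that families_minimal_inscribed minimal_inscribed_iff by blast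
  have coherent_not_two_sided: "\<not> minimal_polyomino.two_sided P c"
    if "minimal_polyomino P" "minimal_polyomino.coherent P c \<sigma>" "\<And>i. \<sigma> i = 1 \<or> \<sigma> i = -1" for c and \<sigma> :: "3 \<Rightarrow> int"
  proof -
    interpret minimal_polyomino P by (rule that(1))
    show ?thesis
    proof
      assume "two_sided c"
      then obtain i where i: "linked c i 1 i (-1)" unfolding two_sided_def by blast
      then have "linked c i (\<sigma> i) i (- \<sigma> i)" using that(3)[of i] linked_sym by auto
      then show False using that(2) unfolding coherent_def by blast
    qed
  qed
  show "\<not> (diagonal a b P \<and> two_by_two a b P)"
  proof
    assume dt: "diagonal a b P \<and> two_by_two a b P"
    interpret minimal_polyomino P using dt P by blast
    obtain c \<sigma> where "c \<in> P" "coherent c \<sigma>" "\<And>i. \<sigma> i = 1 \<or> \<sigma> i = -1" using diagonal_coherent dt by blast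
    then show False
      using coherent_not_two_sided[OF minimal_polyomino_axioms] double_edge_two_sided
        two_by_two_double_edge dt by blast
  qed
  show "\<not> (diagonal a b P \<and> skew_cross a b P)"
  proof
    assume ds: "diagonal a b P \<and> skew_cross a b P"
    interpret minimal_polyomino P using ds P by blast
    obtain c \<sigma> where c: "c \<in> P" "coherent c \<sigma>" "\<And>i. \<sigma> i = 1 \<or> \<sigma> i = -1" using diagonal_coherent ds by blast
    obtain c0 where "c0 \<in> P" "\<not> two_sided c0"
      and c0: "\<And>\<sigma>. (\<And>i. \<sigma> i \<noteq> 0) \<Longrightarrow> \<not> coherent c0 \<sigma>"
        "\<And>c'. c' \<in> P \<Longrightarrow> c' \<noteq> c0 \<Longrightarrow> two_sided c'"
      using skew_cross_cells[OF conjunct2[OF ds]] by metis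
    have "\<sigma> i \<noteq> 0" for i using c(3)[of i] by auto
    then have "c \<noteq> c0" using c0(1) c(2) by blast
    then show False using c0(2) c coherent_not_two_sided[OF minimal_polyomino_axioms] by blast
  qed
  show "\<not> (two_by_two a b P \<and> skew_cross a b P)"
  proof
    assume ts: "two_by_two a b P \<and> skew_cross a b P"
    interpret minimal_polyomino P using ts P by blast
    show False using skew_cross_cells ts double_edge_two_sided two_by_two_double_edge by metis
  qed
qed

theorem theorem3:
  fixes b k h :: nat
  assumes "b > 0" and "k > 0" and "h > 0"
  shows "p_3D_min b k h = diag b k h + p_2Dx2D b k h + sc b k h
    \<and> diag_polyominoes b k h \<inter> two_by_two_polyominoes b k h = {}
    \<and> diag_polyominoes b k h \<inter> skew_cross_polyominoes b k h = {}
    \<and> two_by_two_polyominoes b k h \<inter> skew_cross_polyominoes b k h = {}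
    \<and> diag_polyominoes b k h \<union> two_by_two_polyominoes b k h \<union> skew_cross_polyominoes b k h
        = min_polyominoes b k h"
proof -
  let ?t = "top_cell b k h"
  have "(\<Sum>i\<in>UNIV. \<bar>(0 :: cell) $ i - ?t $ i\<bar> + 1) = int b + int k + int h"
    using assms by (simp add: sum_3 top_cell_def)
  \<comment> \<open>Positive sides sum to at least three, so the truncated subtraction agrees with
    the integer one.\<close>
  then have min_iff: "P \<in> min_polyominoes b k h \<longleftrightarrow> minimal_inscribed 0 ?t P" for P
    unfolding min_polyominoes_def minimal_inscribed_def using assms by auto
  have union: "diag_polyominoes b k h \<union> two_by_two_polyominoes b k h \<union> skew_cross_polyominoes b k h
      = min_polyominoes b k h"
    using minimal_inscribed_cases families_minimal_inscribed min_iff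
    unfolding diag_polyominoes_def two_by_two_polyominoes_def skew_cross_polyominoes_def by blast
  have disj: "diag_polyominoes b k h \<inter> two_by_two_polyominoes b k h = {}"
    "diag_polyominoes b k h \<inter> skew_cross_polyominoes b k h = {}"
    "two_by_two_polyominoes b k h \<inter> skew_cross_polyominoes b k h = {}"
    using families_disjoint
    unfolding diag_polyominoes_def two_by_two_polyominoes_def skew_cross_polyominoes_def by blast+
  have "min_polyominoes b k h \<subseteq> Pow (Box 0 ?t)"
    unfolding min_polyominoes_def inscribed_def by blast
  then have "finite (min_polyominoes b k h)" using finite_Box by (meson finite_Pow_iff finite_subset)
  then have "finite (diag_polyominoes b k h)" "finite (two_by_two_polyominoes b k h)"
    "finite (skew_cross_polyominoes b k h)" unfolding union[symmetric] by auto
  then have "card (min_polyominoes b k h) = card (diag_polyominoes b k h) +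
      card (two_by_two_polyominoes b k h) + card (skew_cross_polyominoes b k h)"
    using disj unfolding union[symmetric] by (subst card_Un_disjoint card_Un_disjoint; auto)+
  then show ?thesis
    using union disj unfolding p_3D_min_def diag_def p_2Dx2D_def sc_def by blast
qed

end
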